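(* Let $V$ be the $\mathcal O_q$-module, with all associated notation ($d$, $a$, $V_i$, $V^*_i$, $V^-_i$, $K$, $B$, $K^\downarrow$, $B^\downarrow$, and the flags $[0],[d],[0^*],[d^*],[0^-],[d^-]$), described in the context. Put $$M=\frac{aK-a^{-1}B}{a-a^{-1}},\qquad M^\downarrow=\frac{aK^\downarrow-a^{-1}B^\downarrow}{a-a^{-1}}.$$ Then, in the sense of "goes from flag to flag" defined in the context: (1) $B$ goes from $[0^*]$ to $[0]$; $K$ goes from $[0^*]$ to $[d]$; $B^\downarrow$ goes from $[d^*]$ to $[0]$; $K^\downarrow$ goes from $[d^*]$ to $[d]$; (2) $a^{-1}A-a^{-2}B$ goes from $[0]$ to $[0^-]$; $aA-a^{2}K$ goes from $[d]$ to $[0^-]$; $a^{-1}A-a^{-2}B^\downarrow$ goes from $[0]$ to $[d^-]$; $aA-a^{2}K^\downarrow$ goes from $[d]$ to $[d^-]$; (3) $M$ goes from $[0^*]$ to $[0^-]$; $M^\downarrow$ goes from $[d^*]$ to $[d^-]$.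
   Context: Setting. $\mathbb F$ is a field and $q\in\mathbb F$ is nonzero and not a root of unity. Algebras are associative, unital, over $\mathbb F$. Write $[X,Y]=XY-YX$, $[X,Y]_q=qXY-q^{-1}YX$, $[X,Y]_{q^{-1}}=q^{-1}XY-qYX$. The $q$-Onsager algebra $\mathcal O_q$ is defined by generators $A,A^*$ and relations $[A,[A,[A,A^*]_q]_{q^{-1}}]=(q^2-q^{-2})^2[A^*,A]$ and $[A^*,[A^*,[A^*,A]_q]_{q^{-1}}]=(q^2-q^{-2})^2[A,A^*]$. $V$ is an irreducible $\mathcal O_q$-module of finite dimension at least $2$ on which each of $A,A^*$ is diagonalizable; elements of $\mathcal O_q$ are identified with their actions on $V$. Eigenspaces. The eigenvalues of $A$ on $V$ can be ordered as mutually distinct $\theta_0,\dots,\theta_d$ ($d\ge 1$) such that $\theta_i=aq^{d-2i}+a^{-1}q^{2i-d}$ ($0\le i\le d$) for some nonzero $a\in\mathbb F$; fix such an ordering and $a$. $V_i$ is the $\theta_i$-eigenspace of $A$ and $E_i\in\mathrm{End}(V)$ is the projection onto $V_i$ along $\bigoplus_{j\ne i}V_j$; one has $A^*V_i\subseteq V_{i-1}+V_i+V_{i+1}$ ($V_{-1}=V_{d+1}=0$). $A^*$ also has exactly $d+1$ eigenspaces on $V$, and they can be ordered $V^*_0,\dots,V^*_d$ so that $AV^*_i\subseteq V^*_{i-1}+V^*_i+V^*_{i+1}$ ($V^*_{-1}=V^*_{d+1}=0$); fix such an ordering and let $\theta_i^*$ be the eigenvalue of $A^*$ on $V^*_i$.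 One has $a^2\ne 1$. Lusztig automorphism. $L$ is the automorphism of $\mathcal O_q$ with $L(A)=A$, $L(A^* )=A^*+\frac{[A,[A,A^*]_q]}{(q-q^{-1})(q^2-q^{-2})}$; its inverse satisfies $L^{-1}(A)=A$, $L^{-1}(A^* )=A^*+\frac{[A,[A,A^*]_{q^{-1}}]}{(q-q^{-1})(q^2-q^{-2})}$. The map $H$. Let $t_{ij}=1+\frac{\theta_i-\theta_j}{q-q^{-1}}\cdot\frac{q\theta_i-q^{-1}\theta_j}{q^2-q^{-2}}$, $t_i=t_{01}t_{12}\cdots t_{i-1,i}$ ($t_0=1$), and $H=\sum_{i=0}^d t_iE_i\in\mathrm{End}(V)$; each $t_i\neq0$, so $H$ is invertible. Put $V^-_i=HV^*_i$ ($0\le i\le d$); $V^-_i$ is the eigenspace of $L^{-1}(A^* )$ on $V$ with eigenvalue $\theta^*_i$. Maps. A decomposition of $V$ is a sequence $\{W_i\}_{i=0}^d$ of nonzero subspaces with direct sum $V$; its corresponding map is the element of $\mathrm{End}(V)$ acting on $W_i$ as $q^{d-2i}$ times the identity ($0\le i\le d$). $K,B,K^\downarrow,B^\downarrow$ are the maps corresponding to the decompositions $\{W_i\}_{i=0}^d$ (each known to be a decomposition) given respectively by: $K$: $W_i=(V^*_0+\cdots+V^*_i)\cap(V_i+\cdots+V_d)$; $B$: $W_i=(V^*_0+\cdots+V^*_i)\cap(V_0+\cdots+V_{d-i})$; $K^\downarrow$: $W_i=(V^*_{d-i}+\cdots+V^*_d)\cap(V_i+\cdots+V_d)$; $B^\downarrow$: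 $W_i=(V^*_{d-i}+\cdots+V^*_d)\cap(V_0+\cdots+V_{d-i})$. Flags. For $0\le i\le d$ put $[0]_i=V_0+\cdots+V_i$, $[d]_i=V_{d-i}+\cdots+V_d$, $[0^*]_i=V^*_0+\cdots+V^*_i$, $[d^*]_i=V^*_{d-i}+\cdots+V^*_d$, $[0^-]_i=V^-_0+\cdots+V^-_i$, $[d^-]_i=V^-_{d-i}+\cdots+V^-_d$; these define flags $[0],[d],[0^*],[d^*],[0^-],[d^-]$. Given flags $F=(F_i)_{i=0}^d$, $G=(G_i)_{i=0}^d$, say $T\in\mathrm{End}(V)$ goes from $F$ to $G$ if $T$ is diagonalizable with eigenvalues $\{q^{d-2i}\}_{i=0}^d$ and, writing $T_i$ for its $q^{d-2i}$-eigenspace, $T_0+\cdots+T_i=F_i$ and $T_{d-i}+\cdots+T_d=G_i$ for $0\le i\le d$. *)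

theory Defs
  imports Complex_Main
    "HOL-Library.Poly_Mapping"
    "HOL-Library.Set_Algebras"
    "HOL-Algebra.QuotRing"
begin

section \<open>The \<open>q\<close>-Onsager algebra\<close>

text \<open>
  The free algebra on the two generators \<open>A\<close>, \<open>A\<^sup>*\<close> is the monoid algebra of the free monoid of
  words.  \<open>Poly_Mapping\<close> provides monoid algebras over additively written (possibly
  noncommutative) monoids, so concatenation of words is written \<open>+\<close>.
\<close>

datatype gen = GenA | GenAstar

datatype word = Word (letters: "gen list")

instantiation word :: monoid_add
begin

definition zero_word :: word where "0 = Word []"

definition plus_word :: "word \<Rightarrow> word \<Rightarrow> word" where "u + v = Word (letters u @ letters v)"

instance by standard (simp_all add: zero_word_def plus_word_def)

end

type_synonym 'f free_algebra = "word \<Rightarrow>\<^sub>0 'f"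

definition free_gen :: "gen \<Rightarrow> 'f::field free_algebra" where
  "free_gen g = Poly_Mapping.single (Word [g]) 1"

definition free_scalar :: "'f::field \<Rightarrow> 'f free_algebra" where
  "free_scalar c = Poly_Mapping.single 0 c"

definition comm :: "'f::field free_algebra \<Rightarrow> 'f free_algebra \<Rightarrow> 'f free_algebra" where
  "comm X Y = X * Y - Y * X"

text \<open>\<open>[X, Y]\<^sub>c = c X Y - c\<^sup>-\<^sup>1 Y X\<close>, used both for \<open>c = q\<close> and for \<open>c = q\<^sup>-\<^sup>1\<close>.\<close>

definition q_comm :: "'f::field \<Rightarrow> 'f free_algebra \<Rightarrow> 'f free_algebra \<Rightarrow> 'f free_algebra" where
  "q_comm c X Y = free_scalar c * (X * Y) - free_scalar (inverse c) * (Y * X)"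

text \<open>
  Left minus right hand side of
  \<open>[X, [X, [X, Y]\<^sub>q]\<^sub>q\<^sub>-\<^sub>1] = (q\<^sup>2 - q\<^sup>-\<^sup>2)\<^sup>2 [Y, X]\<close>, where the inner bracket is the \<open>q\<close>-commutator and the
  middle one the \<open>q\<^sup>-\<^sup>1\<close>-commutator.
\<close>

definition qOnsager_relator :: "'f::field \<Rightarrow> 'f free_algebra \<Rightarrow> 'f free_algebra \<Rightarrow> 'f free_algebra" where
  "qOnsager_relator q X Y =
     comm X (q_comm (inverse q) X (q_comm q X Y))
       - free_scalar ((q ^ 2 - inverse q ^ 2) ^ 2) * comm Y X"

definition free_ring :: "'f::field free_algebra ring" where
  "free_ring = \<lparr>carrier = UNIV, mult = (*), one = 1, zero = 0, add = (+)\<rparr>"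

definition qOnsager_ideal :: "'f::field \<Rightarrow> 'f free_algebra set" where
  "qOnsager_ideal q = genideal free_ring
     {qOnsager_relator q (free_gen GenA) (free_gen GenAstar),
      qOnsager_relator q (free_gen GenAstar) (free_gen GenA)}"

definition qOnsager :: "'f::field \<Rightarrow> 'f free_algebra set ring" where
  "qOnsager q = FactRing free_ring (qOnsager_ideal q)"

definition qOnsager_class :: "'f::field \<Rightarrow> 'f free_algebra \<Rightarrow> 'f free_algebra set" where
  "qOnsager_class q x = a_r_coset free_ring (qOnsager_ideal q) x"

definition qOnsager_gen :: "'f::field \<Rightarrow> gen \<Rightarrow> 'f free_algebra set" where
  "qOnsager_gen q g = qOnsager_class q (free_gen g)"


section \<open>Modules\<close>

text \<open>The vector space \<open>V\<close> is the whole type \<open>'v\<close>, with scalar multiplication \<open>scale\<close>.\<close>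

definition End_ring :: "('f::field \<Rightarrow> 'v::ab_group_add \<Rightarrow> 'v) \<Rightarrow> ('v \<Rightarrow> 'v) ring" where
  "End_ring scale =
     \<lparr>carrier = {T. Vector_Spaces.linear scale scale T}, mult = (\<circ>), one = id,
      zero = (\<lambda>v. 0), add = (\<lambda>S T v. S v + T v)\<rparr>"

text \<open>
  The last conjunct makes the ring homomorphism \<open>\<rho>\<close> a homomorphism of algebras over the field:
  the scalar \<open>c \<cdot> 1\<close> acts as \<open>c\<close> times the identity.
\<close>

definition qOnsager_module ::
  "('f::field \<Rightarrow> 'v::ab_group_add \<Rightarrow> 'v) \<Rightarrow> 'f \<Rightarrow> ('f free_algebra set \<Rightarrow> 'v \<Rightarrow> 'v) \<Rightarrow> bool" where
  "qOnsager_module scale q \<rho> \<longleftrightarrow>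
     vector_space scale \<and>
     \<rho> \<in> ring_hom (qOnsager q) (End_ring scale) \<and>
     (\<forall>c. \<rho> (qOnsager_class q (free_scalar c)) = scale c)"

definition qOnsager_submodule ::
  "('f::field \<Rightarrow> 'v::ab_group_add \<Rightarrow> 'v) \<Rightarrow> 'f \<Rightarrow> ('f free_algebra set \<Rightarrow> 'v \<Rightarrow> 'v) \<Rightarrow> 'v set \<Rightarrow> bool" where
  "qOnsager_submodule scale q \<rho> W \<longleftrightarrow>
     Modules.module.subspace scale W \<and> (\<forall>x \<in> carrier (qOnsager q). \<rho> x ` W \<subseteq> W)"

definition irreducible_qOnsager_module ::
  "('f::field \<Rightarrow> 'v::ab_group_add \<Rightarrow> 'v) \<Rightarrow> 'f \<Rightarrow> ('f free_algebra set \<Rightarrow> 'v \<Rightarrow> 'v) \<Rightarrow> bool" where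
  "irreducible_qOnsager_module scale q \<rho> \<longleftrightarrow>
     qOnsager_module scale q \<rho> \<and>
     (UNIV :: 'v set) \<noteq> {0} \<and>
     (\<forall>W. qOnsager_submodule scale q \<rho> W \<longrightarrow> W = {0} \<or> W = UNIV)"


section \<open>Eigenspaces, flags and maps\<close>

text \<open>Sums of subspaces such as \<open>\<Sum>k\<le>i. V k\<close> are the elementwise sums of \<open>HOL-Library.Set_Algebras\<close>.\<close>

definition eigenspace :: "('f::field \<Rightarrow> 'v::ab_group_add \<Rightarrow> 'v) \<Rightarrow> ('v \<Rightarrow> 'v) \<Rightarrow> 'f \<Rightarrow> 'v set" where
  "eigenspace scale T c = {v. T v = scale c v}"

definition eigenvalues :: "('f::field \<Rightarrow> 'v::ab_group_add \<Rightarrow> 'v) \<Rightarrow> ('v \<Rightarrow> 'v) \<Rightarrow> 'f set" where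
  "eigenvalues scale T = {c. eigenspace scale T c \<noteq> {0}}"

definition diagonalizable :: "('f::field \<Rightarrow> 'v::ab_group_add \<Rightarrow> 'v) \<Rightarrow> ('v \<Rightarrow> 'v) \<Rightarrow> bool" where
  "diagonalizable scale T \<longleftrightarrow>
     Vector_Spaces.linear scale scale T \<and>
     Modules.module.span scale (\<Union>c. eigenspace scale T c) = UNIV"

text \<open>
  \<open>proj scale d V i\<close> is the projection onto \<open>V i\<close> along the sum of the other \<open>V j\<close> (\<open>j \<le> d\<close>), and
  \<open>corresponding_map scale q d W\<close> the map acting on \<open>W i\<close> as \<open>q\<^bsup>d-2i\<^esup>\<close>.  Both are uniquely
  determined when the subspaces are the summands of a direct sum decomposition of the space.
\<close>

definition proj ::
  "('f::field \<Rightarrow> 'v::ab_group_add \<Rightarrow> 'v) \<Rightarrow> nat \<Rightarrow> (nat \<Rightarrow> 'v set) \<Rightarrow> nat \<Rightarrow> 'v \<Rightarrow> 'v" where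
  "proj scale d V i = (THE E. Vector_Spaces.linear scale scale E \<and>
     (\<forall>v \<in> V i. E v = v) \<and> (\<forall>j \<le> d. j \<noteq> i \<longrightarrow> (\<forall>v \<in> V j. E v = 0)))"

definition corresponding_map ::
  "('f::field \<Rightarrow> 'v::ab_group_add \<Rightarrow> 'v) \<Rightarrow> 'f \<Rightarrow> nat \<Rightarrow> (nat \<Rightarrow> 'v set) \<Rightarrow> 'v \<Rightarrow> 'v" where
  "corresponding_map scale q d W = (THE T. Vector_Spaces.linear scale scale T \<and>
     (\<forall>i \<le> d. \<forall>w \<in> W i. T w = scale (q powi (int d - 2 * int i)) w))"

text \<open>For \<open>flag_first V\<close> and \<open>flag_last d V\<close> only the components with index at most \<open>d\<close> are relevant.\<close>

definition flag_first :: "(nat \<Rightarrow> 'v::ab_group_add set) \<Rightarrow> nat \<Rightarrow> 'v set" where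
  "flag_first V i = (\<Sum>k\<le>i. V k)"

definition flag_last :: "nat \<Rightarrow> (nat \<Rightarrow> 'v::ab_group_add set) \<Rightarrow> nat \<Rightarrow> 'v set" where
  "flag_last d V i = (\<Sum>k=d-i..d. V k)"

definition goes_from_to ::
  "('f::field \<Rightarrow> 'v::ab_group_add \<Rightarrow> 'v) \<Rightarrow> 'f \<Rightarrow> nat \<Rightarrow> ('v \<Rightarrow> 'v) \<Rightarrow>
   (nat \<Rightarrow> 'v set) \<Rightarrow> (nat \<Rightarrow> 'v set) \<Rightarrow> bool" where
  "goes_from_to scale q d T F G \<longleftrightarrow>
     diagonalizable scale T \<and>
     eigenvalues scale T = (\<lambda>i. q powi (int d - 2 * int i)) ` {..d} \<and>
     (\<forall>i \<le> d.
        (\<Sum>k\<le>i. eigenspace scale T (q powi (int d - 2 * int k))) = F i \<and>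
        (\<Sum>k=d-i..d. eigenspace scale T (q powi (int d - 2 * int k))) = G i)"

text \<open>\<open>t_entry q \<theta>\<^sub>i \<theta>\<^sub>j\<close> is \<open>t\<^sub>i\<^sub>j\<close> and \<open>t_coeff q \<theta> i\<close> is \<open>t\<^sub>i = t\<^sub>0\<^sub>1 t\<^sub>1\<^sub>2 \<dots> t\<^sub>i\<^sub>-\<^sub>1\<^sub>,\<^sub>i\<close>.\<close>

definition t_entry :: "'f::field \<Rightarrow> 'f \<Rightarrow> 'f \<Rightarrow> 'f" where
  "t_entry q x y =
     1 + (x - y) / (q - inverse q) * ((q * x - inverse q * y) / (q ^ 2 - inverse q ^ 2))"

definition t_coeff :: "'f::field \<Rightarrow> (nat \<Rightarrow> 'f) \<Rightarrow> nat \<Rightarrow> 'f" where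
  "t_coeff q \<theta> i = (\<Prod>k<i. t_entry q (\<theta> k) (\<theta> (Suc k)))"

definition H_map ::
  "('f::field \<Rightarrow> 'v::ab_group_add \<Rightarrow> 'v) \<Rightarrow> 'f \<Rightarrow> nat \<Rightarrow> (nat \<Rightarrow> 'f) \<Rightarrow> (nat \<Rightarrow> 'v set) \<Rightarrow> 'v \<Rightarrow> 'v" where
  "H_map scale q d \<theta> V v = (\<Sum>i\<le>d. scale (t_coeff q \<theta> i) (proj scale d V i v))"

end

theory Submission
  imports Defs
begin

text \<open>
  A map goes from one flag to another exactly when it is triangular, with the prescribed diagonal
  entries, on each of the two flags: on the \<open>i\<close>-th step of the first it is \<open>q\<^bsup>d-2i\<^esup>\<close> modulo the
  preceding step, on the second \<open>q\<^bsup>2i-d\<^esup>\<close> (\<open>goes_from_toI\<close>).  Triangularity is linear in the map, so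
  everything reduces to finding the diagonal entries of a few maps on a few flags.

  Projecting the first \<open>q\<close>-Onsager relation to eigenspaces of \<open>A\<close> shows that \<open>A\<^sup>*\<close> acts on them
  tridiagonally (\<open>tridiagonal_B\<close>), just as \<open>A\<close> acts on those of \<open>A\<^sup>*\<close> by hypothesis.  Take a flag
  \<open>P\<close> of partial sums of eigenspaces of \<open>A\<^sup>*\<close> and a flag \<open>R\<close> of partial sums of eigenspaces of \<open>A\<close>, each in either of its orders.
  Irreducibility makes these flags opposite, so their intersections form a decomposition \<open>U\<close> of the
  space that recovers both flags (\<open>decomposition_U\<close>, following Ito, Tanabe and Terwilliger).  The map
  corresponding to \<open>U\<close> is therefore triangular on \<open>P\<close> and on \<open>R\<close>, which gives the four assertions about
  \<open>K\<close>, \<open>B\<close>, \<open>K\<^sup>\<down>\<close>, \<open>B\<^sup>\<down>\<close> (\<open>corresponding_map_lowers\<close>).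

  Write \<open>C\<close> for this map, \<open>\<alpha>\<close> for \<open>a\<close> or \<open>a\<^sup>-\<^sup>1\<close> according to the order of \<open>R\<close>, and \<open>T = \<alpha> A - \<alpha>\<^sup>2 C\<close>.  On \<open>R\<close>
  both \<open>A\<close> and \<open>C\<close> are triangular, and the entries of \<open>T\<close> come out as \<open>q\<^bsup>d-2i\<^esup>\<close>.  The other flag is the image of
  \<open>P\<close> under \<open>H\<close>, and the heart of the matter is that \<open>H\<close> maps \<open>U\<^sub>i\<close> into the eigenspace of \<open>T\<close> for
  \<open>q\<^bsup>2i-d\<^esup>\<close> (\<open>T_H\<close>).  On \<open>U\<^sub>i\<close> the map \<open>A\<close> is \<open>\<zeta>\<^sub>i = x + x\<^sup>-\<^sup>1\<close>, with \<open>x = \<alpha> q\<^bsup>d-2i\<^esup>\<close>, plus a raising map \<open>\<psi>\<close>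
  into \<open>U\<^sub>i\<^sub>+\<^sub>1\<close>, and \<open>T\<close> is \<open>q\<^bsup>2i-d\<^esup> + \<alpha> \<psi>\<close>.  Hence \<open>T\<close> has the eigenvector
  \<open>\<Sum>\<^sub>k x\<^sup>k / (q\<^sup>2; q\<^sup>2)\<^sub>k \<psi>\<^sup>k u\<close> for every \<open>u \<in> U\<^sub>i\<close>.  The same series is a multiple of \<open>H u\<close>: the factors
  \<open>t\<^sub>i\<close> are exactly those for which the series, scaled by them, is compatible with the action of \<open>A\<close>,
  and a map with this compatibility and the same diagonal entries as \<open>H\<close> agrees with \<open>H\<close>
  (\<open>H_eq_q_exp_series\<close>).

  Finally \<open>a K - a\<^sup>-\<^sup>1 B = a (a\<^sup>-\<^sup>1 A - a\<^sup>-\<^sup>2 B) - a\<^sup>-\<^sup>1 (a A - a\<^sup>2 K)\<close>.  On the flag of \<open>A\<^sup>*\<close> the maps \<open>K\<close> and \<open>B\<close> have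
  the same diagonal entries, and on its image under \<open>H\<close> so do the two maps in parentheses.  Since
  \<open>M\<close> is the combination with coefficients \<open>a / (a - a\<^sup>-\<^sup>1)\<close> and \<open>- a\<^sup>-\<^sup>1 / (a - a\<^sup>-\<^sup>1)\<close>, whose sum is 1, it
  has those same entries on both flags (\<open>split_maps_go\<close>).
\<close>

section \<open>Maps acting triangularly on a flag\<close>

lemma sum_atMost_reverse: "i \<le> d \<Longrightarrow> (\<Sum>k=d-i..d. W k) = (\<Sum>k\<le>i. W (d - k))"
  for W :: "nat \<Rightarrow> 'a::comm_monoid_add"
  by (rule sum.reindex_bij_witness[of _ "\<lambda>k. d - k" "\<lambda>k. d - k"]) auto

lemma powi_inj:
  fixes q :: "'a::field"
  assumes q0: "q \<noteq> 0" and root: "\<And>n::nat. n > 0 \<Longrightarrow> q ^ n \<noteq> 1" and eq: "q powi m = q powi n"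
  shows "m = n"
proof -
  have *: "k = 0" if "q powi k = 1" for k
  proof (cases "k \<ge> 0")
    case True
    then have "q ^ nat k = 1" using that by (simp add: power_int_def)
    then have "\<not> nat k > 0" using root by blast
    then show ?thesis using True by simp
  next
    case False
    then have "q ^ nat (- k) = 1"
      using that q0 by (simp add: power_int_def power_inverse)
    then have "\<not> nat (- k) > 0" using root by blast
    then show ?thesis using False by simp
  qed
  have "q powi (m - n) = 1" using eq q0 by (simp add: power_int_diff)
  then show ?thesis using *[of "m - n"] by simp
qed

locale operators_on_vector_space = vector_space scale
  for scale :: "'f::field \<Rightarrow> 'v::ab_group_add \<Rightarrow> 'v" (infixr "*s" 75)
begin

abbreviation endo :: "('v \<Rightarrow> 'v) \<Rightarrow> bool" where
  "endo \<equiv> Vector_Spaces.linear scale scale"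

lemma endo_iff:
  "endo T \<longleftrightarrow> (\<forall>u v. T (u + v) = T u + T v) \<and> (\<forall>c v. T (c *s v) = c *s T v)"
  using vector_space_axioms by (simp add: Vector_Spaces.linear_iff)

lemma endo_add: "endo T \<Longrightarrow> T (u + v) = T u + T v"
  by (simp add: endo_iff)

lemma endo_scale: "endo T \<Longrightarrow> T (c *s v) = c *s T v"
  by (simp add: endo_iff)

lemma endo_zero: "endo T \<Longrightarrow> T 0 = 0"
  by (metis endo_scale scale_zero_left)

lemma endo_diff: "endo T \<Longrightarrow> T (u - v) = T u - T v"
  by (metis add_diff_cancel diff_add_cancel endo_add)

lemma endo_sum: "endo T \<Longrightarrow> T (\<Sum>i\<in>I. f i) = (\<Sum>i\<in>I. T (f i))"
  by (induction I rule: infinite_finite_induct) (simp_all add: endo_zero endo_add)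

lemma endo_combination:
  "endo S \<Longrightarrow> endo T \<Longrightarrow> endo (\<lambda>v. c *s S v - e *s T v)"
  by (simp add: endo_iff scale_right_distrib scale_right_diff_distrib algebra_simps)

lemma subspace_image_endo: "endo T \<Longrightarrow> subspace W \<Longrightarrow> subspace (T ` W)"
  by (rule module_hom.subspace_image) (auto simp: module_hom_iff_linear)

lemma subspace_eigenspace: "endo T \<Longrightarrow> subspace (eigenspace scale T c)"
  by (rule subspaceI)
     (auto simp: eigenspace_def endo_zero endo_add endo_scale scale_right_distrib mult.commute)

lemma mem_sum_sets_iff:
  "finite I \<Longrightarrow> v \<in> (\<Sum>i\<in>I. W i) \<longleftrightarrow> (\<exists>w. (\<forall>i\<in>I. w i \<in> W i) \<and> v = (\<Sum>i\<in>I. w i))"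
  by (auto simp: set_sum_alt)

lemma subspace_sum_sets:
  assumes "finite I" and "\<And>i. i \<in> I \<Longrightarrow> subspace (W i)"
  shows "subspace (\<Sum>i\<in>I. W i)"
  using assms
proof (induction I rule: finite_induct)
  case empty
  then show ?case by simp
next
  case (insert i I)
  have "W i + (\<Sum>i\<in>I. W i) = {x + y | x y. x \<in> W i \<and> y \<in> (\<Sum>i\<in>I. W i)}"
    by (auto simp: set_plus_def)
  then show ?case using insert by (simp add: subspace_sums)
qed

lemma mem_sum_sets:
  assumes "finite I" "\<And>i. i \<in> I \<Longrightarrow> subspace (W i)" "i \<in> I" "v \<in> W i"
  shows "v \<in> (\<Sum>i\<in>I. W i)"
  unfolding mem_sum_sets_iff[OF assms(1)]
  using assms by (intro exI[of _ "\<lambda>j. if j = i then v else 0"]) (auto intro: subspace_0)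

lemma sum_sets_subset:
  assumes "finite I" "subspace S" "\<And>i. i \<in> I \<Longrightarrow> W i \<subseteq> S"
  shows "(\<Sum>i\<in>I. W i) \<subseteq> S"
proof
  fix v assume "v \<in> (\<Sum>i\<in>I. W i)"
  then obtain w where "\<forall>i\<in>I. w i \<in> W i" "v = (\<Sum>i\<in>I. w i)"
    using assms(1) by (auto simp: mem_sum_sets_iff)
  then show "v \<in> S" using assms by (auto intro!: subspace_sum)
qed

text \<open>
  Flags are indexed from the zero subspace on, so that the condition \<open>(T - c\<^sub>i) F\<^sub>i \<subseteq> F\<^sub>i\<^sub>-\<^sub>1\<close> needs no
  separate treatment of \<open>i = 0\<close>.
\<close>

definition flag :: "nat \<Rightarrow> (nat \<Rightarrow> 'v set) \<Rightarrow> bool" where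
  "flag d P \<longleftrightarrow> P 0 = {0} \<and> P (Suc d) = UNIV \<and> (\<forall>i\<le>Suc d. subspace (P i)) \<and>
     (\<forall>i\<le>d. P i \<subset> P (Suc i))"

definition lowers :: "nat \<Rightarrow> ('v \<Rightarrow> 'v) \<Rightarrow> (nat \<Rightarrow> 'f) \<Rightarrow> (nat \<Rightarrow> 'v set) \<Rightarrow> bool" where
  "lowers d T c P \<longleftrightarrow> (\<forall>i\<le>d. \<forall>v \<in> P (Suc i). T v - c i *s v \<in> P i)"

lemma flag_mono:
  assumes "flag d P" "i \<le> j" "j \<le> Suc d" shows "P i \<subseteq> P j"
  using assms(2,3)
proof (induction j rule: dec_induct)
  case (step n)
  then have "P n \<subseteq> P (Suc n)" using assms(1) by (auto simp: flag_def)
  then show ?case using step by auto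
qed simp

lemma flag_subspace: "flag d P \<Longrightarrow> i \<le> Suc d \<Longrightarrow> subspace (P i)"
  by (simp add: flag_def)

lemma lowers_cong:
  "lowers d T c P \<Longrightarrow> (\<And>i. i \<le> d \<Longrightarrow> c i = e i) \<Longrightarrow> lowers d T e P"
  by (simp add: lowers_def)

lemma lowers_combination:
  assumes P: "flag d P" and S: "lowers d S c P" and T: "lowers d T e P"
  shows "lowers d (\<lambda>v. x *s S v - y *s T v) (\<lambda>i. x * c i - y * e i) P"
  unfolding lowers_def
proof (intro allI impI ballI)
  fix i v assume i: "i \<le> d" and v: "v \<in> P (Suc i)"
  have sub: "subspace (P i)" using P i by (auto intro: flag_subspace)
  have "S v - c i *s v \<in> P i" "T v - e i *s v \<in> P i"
    using S T i v by (auto simp: lowers_def)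
  then have "x *s (S v - c i *s v) - y *s (T v - e i *s v) \<in> P i"
    using sub by (metis subspace_diff subspace_scale)
  then show "x *s S v - y *s T v - (x * c i - y * e i) *s v \<in> P i"
    by (simp add: algebra_simps)
qed

text \<open>
  An eigenvector for \<open>c\<close> descends through every step of the flag at which the diagonal entry
  differs from \<open>c\<close>, because there \<open>(T - c\<^sub>i) v\<close> is a nonzero multiple of \<open>v\<close>.
\<close>

lemma eigenvector_descends:
  assumes P: "flag d P" and T: "lowers d T c P" and v: "T v = e *s v"
    and "v \<in> P j" "j \<le> Suc d" "i \<le> j" and ne: "\<And>k. i \<le> k \<Longrightarrow> k < j \<Longrightarrow> c k \<noteq> e"
  shows "v \<in> P i"
  using assms(6,4,5) ne
proof (induction i rule: inc_induct)
  case base then show ?case by simp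
next
  case (step n)
  then have "v \<in> P (Suc n)" by auto
  then have "T v - c n *s v \<in> P n" using T step by (auto simp: lowers_def)
  then have "(e - c n) *s v \<in> P n"
    by (simp add: v scale_left_diff_distrib)
  then have "inverse (e - c n) *s ((e - c n) *s v) \<in> P n"
    using flag_subspace[OF P, of n] step.hyps \<open>j \<le> Suc d\<close> by (intro subspace_scale[of "P n" "(e - c n) *s v"]) auto
  moreover have "e - c n \<noteq> 0" using step by auto
  ultimately show ?case by simp
qed

text \<open>
  One inclusion is descent of eigenvectors.  For the other, a vector \<open>v\<close> of the \<open>i\<close>-th step is
  corrected inductively: \<open>(T - c\<^sub>i) v\<close> already is a sum of eigenvectors for earlier diagonal entries,
  and \<open>T - c\<^sub>i\<close> is invertible on that sum.
\<close>

lemma flag_eq_sum_eigenspaces: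
  assumes P: "flag d P" and T: "lowers d T c P" and lin: "endo T" and inj: "inj_on c {..d}"
    and i: "i \<le> d"
  shows "(\<Sum>k\<le>i. eigenspace scale T (c k)) = P (Suc i)"
proof
  have sub: "subspace (eigenspace scale T (c k))" for k
    using lin by (rule subspace_eigenspace)
  have "eigenspace scale T (c k) \<subseteq> P (Suc i)" if "k \<le> i" for k
  proof
    fix v assume "v \<in> eigenspace scale T (c k)"
    then have v: "T v = c k *s v" by (simp add: eigenspace_def)
    have "c l \<noteq> c k" if "Suc i \<le> l" "l < Suc d" for l
      using inj_onD[OF inj, of l k] that \<open>k \<le> i\<close> i by auto
    then show "v \<in> P (Suc i)"
      using eigenvector_descends[OF P T v, of "Suc d" "Suc i"] P i by (auto simp: flag_def)
  qed
  then show "(\<Sum>k\<le>i. eigenspace scale T (c k)) \<subseteq> P (Suc i)"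
    using flag_subspace[OF P, of "Suc i"] i by (intro sum_sets_subset) auto
  show "P (Suc i) \<subseteq> (\<Sum>k\<le>i. eigenspace scale T (c k))"
    using i
  proof (induction i)
    case 0
    then show ?case using T P by (auto simp: lowers_def flag_def eigenspace_def)
  next
    case (Suc i)
    show ?case
    proof
      fix v assume v: "v \<in> P (Suc (Suc i))"
      then have "T v - c (Suc i) *s v \<in> P (Suc i)" using T Suc.prems by (auto simp: lowers_def)
      then have "T v - c (Suc i) *s v \<in> (\<Sum>k\<le>i. eigenspace scale T (c k))" using Suc by auto
      then obtain w where w: "\<And>k. k \<le> i \<Longrightarrow> T (w k) = c k *s w k"
        and Tv: "T v - c (Suc i) *s v = (\<Sum>k\<le>i. w k)"
        by (auto simp: mem_sum_sets_iff eigenspace_def)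
      \<comment> \<open>Dividing each component by the difference of eigenvalues gives a preimage under
        \<open>T - c (Suc i)\<close> in the sum of the earlier eigenspaces.\<close>
      define w' where "w' k = inverse (c k - c (Suc i)) *s w k" for k
      have w': "w' k \<in> eigenspace scale T (c k)" if "k \<le> i" for k
        using w[OF that] by (simp add: w'_def eigenspace_def endo_scale[OF lin] mult.commute)
      have ne: "c k - c (Suc i) \<noteq> 0" if "k \<le> i" for k
        using inj_onD[OF inj, of k "Suc i"] that Suc.prems by auto
      have "T (\<Sum>k\<le>i. w' k) - c (Suc i) *s (\<Sum>k\<le>i. w' k) = (\<Sum>k\<le>i. (c k - c (Suc i)) *s w' k)"
        using w' by (simp add: endo_sum[OF lin] eigenspace_def scale_sum_right sum_subtractf
            scale_left_diff_distrib)
      also have "\<dots> = (\<Sum>k\<le>i. w k)"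
        by (rule sum.cong) (use ne in \<open>auto simp: w'_def\<close>)
      finally have "v - (\<Sum>k\<le>i. w' k) \<in> eigenspace scale T (c (Suc i))"
        using Tv by (simp add: eigenspace_def endo_diff[OF lin] algebra_simps)
      moreover have "(\<Sum>k\<le>i. w' k) \<in> (\<Sum>k\<le>i. eigenspace scale T (c k))"
        using w' by (auto simp: mem_sum_sets_iff)
      ultimately have "(\<Sum>k\<le>i. w' k) + (v - (\<Sum>k\<le>i. w' k)) \<in> (\<Sum>k\<le>Suc i. eigenspace scale T (c k))"
        unfolding sum.atMost_Suc by (rule set_plus_intro[rotated])
      then show "v \<in> (\<Sum>k\<le>Suc i. eigenspace scale T (c k))" by simp
    qed
  qed
qed

lemma diagonalizable_if_lowers:
  assumes P: "flag d P" and T: "lowers d T c P" and lin: "endo T" and inj: "inj_on c {..d}"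
  shows "diagonalizable scale T" and "eigenvalues scale T = c ` {..d}"
proof -
  note eq = flag_eq_sum_eigenspaces[OF P T lin inj]
  have "(\<Sum>k\<le>d. eigenspace scale T (c k)) \<subseteq> span (\<Union>e. eigenspace scale T e)"
    by (intro sum_sets_subset) (auto intro: span_base)
  then show "diagonalizable scale T"
    using eq[of d] P lin by (auto simp: diagonalizable_def flag_def)
  have "c i \<in> eigenvalues scale T" if i: "i \<le> d" for i
  proof (rule ccontr)
    assume "c i \<notin> eigenvalues scale T"
    then have 0: "eigenspace scale T (c i) = {0}" by (simp add: eigenvalues_def)
    have "P (Suc i) = P i"
    proof (cases i)
      case 0
      then show ?thesis using eq[of 0] \<open>eigenspace scale T (c i) = {0}\<close> P by (simp add: flag_def)
    next
      case (Suc j)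
      then show ?thesis using eq[of i] eq[of j] 0 i
        by (simp flip: set_zero)
    qed
    then show False using P i by (auto simp: flag_def)
  qed
  moreover have "e \<in> c ` {..d}" if "e \<in> eigenvalues scale T" for e
  proof (rule ccontr)
    assume e: "e \<notin> c ` {..d}"
    have "eigenspace scale T e \<noteq> {0}" using that by (simp add: eigenvalues_def)
    then obtain v where v: "T v = e *s v" "v \<noteq> 0"
      using subspace_0[OF subspace_eigenspace[OF lin, of e]]
      unfolding eigenspace_def by blast
    have "v \<in> P 0"
      by (rule eigenvector_descends[OF P T v(1), of "Suc d"]) (use P e in \<open>auto simp: flag_def\<close>)
    then show False using v P by (simp add: flag_def)
  qed
  ultimately show "eigenvalues scale T = c ` {..d}" by auto
qed

text \<open>
  Going from one flag to another is a triangularity condition on each of the two flags.  This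
  criterion is linear in the map, which is what makes the maps \<open>M\<close> and \<open>M\<^sup>\<down>\<close> tractable.
\<close>

lemma goes_from_toI:
  assumes q0: "q \<noteq> 0" and root: "\<And>n::nat. n > 0 \<Longrightarrow> q ^ n \<noteq> 1"
    and lin: "endo T"
    and P: "flag d P" and R: "flag d R"
    and TP: "lowers d T (\<lambda>i. q powi (int d - 2 * int i)) P"
    and TR: "lowers d T (\<lambda>i. q powi (2 * int i - int d)) R"
    and F: "\<And>i. i \<le> d \<Longrightarrow> F i = P (Suc i)"
    and G: "\<And>i. i \<le> d \<Longrightarrow> G i = R (Suc i)"
  shows "goes_from_to scale q d T F G"
proof -
  have inj: "inj_on (\<lambda>i. q powi (int d - 2 * int i)) {..d}"
    and inj': "inj_on (\<lambda>i. q powi (2 * int i - int d)) {..d}"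
    by (rule inj_onI, drule powi_inj[OF q0 root, rotated], simp_all)+
  have "(\<Sum>k=d-i..d. eigenspace scale T (q powi (int d - 2 * int k))) = R (Suc i)"
    if i: "i \<le> d" for i
  proof -
    have "(\<Sum>k\<le>i. eigenspace scale T (q powi (int d - 2 * int (d - k)))) =
        (\<Sum>k\<le>i. eigenspace scale T (q powi (2 * int k - int d)))"
      using i by (intro sum.cong refl arg_cong[where f = "\<lambda>k. eigenspace scale T (q powi k)"]) auto
    then show ?thesis
      using i flag_eq_sum_eigenspaces[OF R TR lin inj' i] by (simp add: sum_atMost_reverse)
  qed
  then show ?thesis
    using diagonalizable_if_lowers[OF P TP lin inj] flag_eq_sum_eigenspaces[OF P TP lin inj] F G
    by (simp add: goes_from_to_def)
qed

end

section \<open>Direct sum decompositions and the maps they determine\<close>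

context operators_on_vector_space
begin

definition direct_decomposition :: "nat \<Rightarrow> (nat \<Rightarrow> 'v set) \<Rightarrow> bool" where
  "direct_decomposition d W \<longleftrightarrow> (\<forall>i\<le>d. subspace (W i)) \<and>
     (\<forall>v. \<exists>w. (\<forall>i\<le>d. w i \<in> W i) \<and> v = (\<Sum>i\<le>d. w i)) \<and>
     (\<forall>w. (\<forall>i\<le>d. w i \<in> W i) \<and> (\<Sum>i\<le>d. w i) = 0 \<longrightarrow> (\<forall>i\<le>d. w i = 0))"

lemma decomposition_subspace: "direct_decomposition d W \<Longrightarrow> i \<le> d \<Longrightarrow> subspace (W i)"
  by (simp add: direct_decomposition_def)

lemma decomposition_components:
  assumes "direct_decomposition d W"
  obtains w where "\<And>i. i \<le> d \<Longrightarrow> w i \<in> W i" "v = (\<Sum>i\<le>d. w i)"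
  using assms unfolding direct_decomposition_def by blast

lemma decomposition_unique:
  assumes W: "direct_decomposition d W"
    and "\<And>i. i \<le> d \<Longrightarrow> x i \<in> W i" "\<And>i. i \<le> d \<Longrightarrow> y i \<in> W i"
    and "(\<Sum>i\<le>d. x i) = (\<Sum>i\<le>d. y i)" and i: "i \<le> d"
  shows "x i = y i"
proof -
  have mem: "\<forall>i\<le>d. x i - y i \<in> W i"
    using assms(2,3) by (auto intro: subspace_diff decomposition_subspace[OF W])
  have sum0: "(\<Sum>i\<le>d. x i - y i) = 0" unfolding sum_subtractf assms(4) by simp
  have indep: "\<forall>w. (\<forall>i\<le>d. w i \<in> W i) \<and> (\<Sum>i\<le>d. w i) = 0 \<longrightarrow> (\<forall>i\<le>d. w i = 0)"
    using W unfolding direct_decomposition_def by (elim conjE)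
  have "\<forall>i\<le>d. x i - y i = 0"
    by (rule mp[OF spec[OF indep]], rule conjI[OF mem sum0])
  then have "x i - y i = 0" using i by blast
  then show ?thesis by simp
qed

lemma decomposition_reverse:
  assumes W: "direct_decomposition d W"
  shows "direct_decomposition d (\<lambda>i. W (d - i))"
proof -
  have rev: "(\<Sum>k\<le>d. f (d - k)) = (\<Sum>k\<le>d. f k)" for f :: "nat \<Rightarrow> 'v"
    using sum_atMost_reverse[of d d f] by (simp add: atLeast0AtMost)
  have "\<exists>w. (\<forall>i\<le>d. w i \<in> W (d - i)) \<and> v = (\<Sum>i\<le>d. w i)" for v
  proof -
    obtain w where "\<And>i. i \<le> d \<Longrightarrow> w i \<in> W i" "v = (\<Sum>i\<le>d. w i)"
      using decomposition_components[OF W, of v] by blast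
    then show ?thesis by (intro exI[of _ "\<lambda>i. w (d - i)"]) (simp add: rev)
  qed
  moreover have "w i = 0" if w: "\<forall>i\<le>d. w i \<in> W (d - i)" "(\<Sum>i\<le>d. w i) = 0" and i: "i \<le> d" for w i
  proof -
    have mem: "w (d - k) \<in> W k" if "k \<le> d" for k using w(1)[rule_format, of "d - k"] that by simp
    have sum0: "(\<Sum>k\<le>d. w (d - k)) = (\<Sum>k\<le>d. 0)" using w(2) rev[of w] by simp
    have "w (d - (d - i)) = 0"
      by (rule decomposition_unique[OF W mem _ sum0])
         (auto intro: subspace_0 decomposition_subspace[OF W])
    then show ?thesis using i by simp
  qed
  ultimately show ?thesis
    using decomposition_subspace[OF W] by (simp add: direct_decomposition_def)
qed

text \<open>
  This justifies the definite descriptions in \<open>corresponding_map\<close> and \<open>proj\<close>: the first prescribes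
  the scalars \<open>q\<^bsup>d-2i\<^esup>\<close>, the second the scalars 1 and 0.
\<close>

lemma ex1_map_scaling_summands:
  assumes W: "direct_decomposition d W"
  shows "\<exists>!T. endo T \<and> (\<forall>i\<le>d. \<forall>w \<in> W i. T w = c i *s w)"
proof (rule ex_ex1I)
  have "\<exists>w. (\<forall>i\<le>d. w i \<in> W i) \<and> v = (\<Sum>i\<le>d. w i)" for v
    using W by (auto simp: direct_decomposition_def)
  then obtain w where w: "\<And>v i. i \<le> d \<Longrightarrow> w v i \<in> W i" and sum_w: "\<And>v. (\<Sum>i\<le>d. w v i) = v"
    by metis
  have wI: "w v i = x i" if "\<And>i. i \<le> d \<Longrightarrow> x i \<in> W i" "(\<Sum>i\<le>d. x i) = v" "i \<le> d" for v x i
    by (rule decomposition_unique[OF W, of "w v" x]) (use that w sum_w in auto)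
  have w_add: "w (u + v) i = w u i + w v i" if "i \<le> d" for u v i
    by (rule wI) (auto simp: sum.distrib sum_w that intro: subspace_add decomposition_subspace[OF W] w)
  have w_scale: "w (e *s v) i = e *s w v i" if "i \<le> d" for e v i
    by (rule wI)
       (auto simp: scale_sum_right[symmetric] sum_w that intro: subspace_scale decomposition_subspace[OF W] w)
  have w_summand: "w v j = (if j = i then v else 0)" if "v \<in> W i" "i \<le> d" "j \<le> d" for v i j
    by (rule wI) (auto simp: that intro: subspace_0 decomposition_subspace[OF W])
  let ?T = "\<lambda>v. \<Sum>i\<le>d. c i *s w v i"
  have "endo ?T"
    by (simp add: endo_iff w_add w_scale scale_right_distrib sum.distrib scale_sum_right mult.commute)
  moreover have "?T v = c i *s v" if "v \<in> W i" "i \<le> d" for v i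
  proof -
    have "?T v = (\<Sum>j\<le>d. if j = i then c i *s v else 0)"
      by (rule sum.cong) (auto simp: w_summand[OF that])
    then show ?thesis using that by simp
  qed
  ultimately show "\<exists>T. endo T \<and> (\<forall>i\<le>d. \<forall>w \<in> W i. T w = c i *s w)" by blast
next
  fix S T
  assume S: "endo S \<and> (\<forall>i\<le>d. \<forall>w \<in> W i. S w = c i *s w)"
    and T: "endo T \<and> (\<forall>i\<le>d. \<forall>w \<in> W i. T w = c i *s w)"
  show "S = T"
  proof
    fix v
    obtain w where w: "\<And>i. i \<le> d \<Longrightarrow> w i \<in> W i" "v = (\<Sum>i\<le>d. w i)"
      using decomposition_components[OF W, of v] by blast
    have "S (w i) = c i *s w i" "T (w i) = c i *s w i" if "i \<le> d" for i
      using S T w(1)[OF that] that by blast+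
    then have "(\<Sum>i\<le>d. S (w i)) = (\<Sum>i\<le>d. T (w i))" by simp
    then show "S v = T v"
      unfolding w(2) endo_sum[OF conjunct1[OF S]] endo_sum[OF conjunct1[OF T]] .
  qed
qed

lemma corresponding_map:
  assumes "direct_decomposition d W"
  shows "endo (corresponding_map scale q d W)"
    and "\<And>i w. i \<le> d \<Longrightarrow> w \<in> W i \<Longrightarrow>
      corresponding_map scale q d W w = q powi (int d - 2 * int i) *s w"
proof -
  have C: "endo (corresponding_map scale q d W) \<and>
      (\<forall>i\<le>d. \<forall>w \<in> W i. corresponding_map scale q d W w = q powi (int d - 2 * int i) *s w)"
    unfolding corresponding_map_def by (rule theI'[OF ex1_map_scaling_summands[OF assms]])
  show "endo (corresponding_map scale q d W)" using C by (rule conjunct1)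
  show "\<And>i w. i \<le> d \<Longrightarrow> w \<in> W i \<Longrightarrow>
      corresponding_map scale q d W w = q powi (int d - 2 * int i) *s w" using C by simp
qed

lemma proj_decomposition:
  assumes W: "direct_decomposition d W" and i: "i \<le> d"
  shows "endo (proj scale d W i)"
    and "\<And>j v. j \<le> d \<Longrightarrow> v \<in> W j \<Longrightarrow> proj scale d W i v = (if j = i then v else 0)"
proof -
  have "(\<forall>j\<le>d. \<forall>w \<in> W j. T w = (if j = i then 1 else 0) *s w) \<longleftrightarrow>
      (\<forall>v \<in> W i. T v = v) \<and> (\<forall>j\<le>d. j \<noteq> i \<longrightarrow> (\<forall>v \<in> W j. T v = 0))" for T
    using i by auto
  then have "\<exists>!T. endo T \<and> (\<forall>v \<in> W i. T v = v) \<and> (\<forall>j\<le>d. j \<noteq> i \<longrightarrow> (\<forall>v \<in> W j. T v = 0))"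
    using ex1_map_scaling_summands[OF W, of "\<lambda>j. if j = i then 1 else 0"] by simp
  then have E: "endo (proj scale d W i) \<and> (\<forall>v \<in> W i. proj scale d W i v = v) \<and>
      (\<forall>j\<le>d. j \<noteq> i \<longrightarrow> (\<forall>v \<in> W j. proj scale d W i v = 0))"
    unfolding proj_def by (rule theI')
  show "endo (proj scale d W i)" using E by (rule conjunct1)
  show "proj scale d W i v = (if j = i then v else 0)" if "j \<le> d" "v \<in> W j" for j v
  proof (cases "j = i")
    case True
    then show ?thesis using bspec[OF conjunct1[OF conjunct2[OF E]]] that(2) by simp
  next
    case False
    then show ?thesis
      using conjunct2[OF conjunct2[OF E], rule_format, OF that(1) False that(2)] by simp
  qed
qed

lemma H_map_decomposition:
  assumes W: "direct_decomposition d W"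
  shows "endo (H_map scale q d \<theta> W)"
    and "\<And>j v. j \<le> d \<Longrightarrow> v \<in> W j \<Longrightarrow> H_map scale q d \<theta> W v = t_coeff q \<theta> j *s v"
proof -
  show "endo (H_map scale q d \<theta> W)"
    unfolding endo_iff H_map_def
    using proj_decomposition(1)[OF W]
    by (simp add: endo_add endo_scale scale_right_distrib sum.distrib scale_sum_right mult.commute)
  fix j v assume j: "j \<le> d" and v: "v \<in> W j"
  have "H_map scale q d \<theta> W v = (\<Sum>i\<le>d. if i = j then t_coeff q \<theta> j *s v else 0)"
    unfolding H_map_def by (rule sum.cong) (auto simp: proj_decomposition(2)[OF W _ j v])
  then show "H_map scale q d \<theta> W v = t_coeff q \<theta> j *s v" using j by simp
qed

lemma eigenvectors_independent:
  assumes T: "endo T" and inj: "inj_on c {..<n::nat}"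
    and w: "\<And>k. k < n \<Longrightarrow> T (w k) = c k *s w k" and sum0: "(\<Sum>k<n. w k) = 0" and "k < n"
  shows "w k = 0"
  using inj w sum0 \<open>k < n\<close>
proof (induction n arbitrary: w k)
  case (Suc n)
  have "(\<Sum>k<n. (c k - c n) *s w k) = (\<Sum>k<Suc n. (c k - c n) *s w k)" by simp
  also have "\<dots> = T (\<Sum>k<Suc n. w k) - c n *s (\<Sum>k<Suc n. w k)"
    unfolding endo_sum[OF T] scale_sum_right sum_subtractf[symmetric]
    by (rule sum.cong) (auto simp: Suc.prems(2) scale_left_diff_distrib)
  finally have 0: "(\<Sum>k<n. (c k - c n) *s w k) = 0"
    using Suc.prems(3) by (simp add: endo_zero[OF T])
  have "w k = 0" if k: "k < n" for k
  proof -
    have "(c k - c n) *s w k = 0"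
      by (rule Suc.IH[of "\<lambda>k. (c k - c n) *s w k"])
         (use Suc.prems(1,2) 0 k in \<open>auto simp: endo_scale[OF T] mult.commute intro: inj_on_subset\<close>)
    moreover have "c k - c n \<noteq> 0" using inj_onD[OF Suc.prems(1), of k n] k by auto
    ultimately show ?thesis by simp
  qed
  then show ?case using Suc.prems(3,4) by (cases "k = n") auto
qed simp

lemma eigenspace_decomposition:
  assumes diag: "diagonalizable scale T" and ev: "eigenvalues scale T = c ` {..d}"
    and inj: "inj_on c {..d}"
  shows "direct_decomposition d (\<lambda>i. eigenspace scale T (c i))"
    and "\<And>i. i \<le> d \<Longrightarrow> eigenspace scale T (c i) \<noteq> {0}"
proof -
  let ?W = "\<lambda>i. eigenspace scale T (c i)"
  have T: "endo T" using diag by (simp add: diagonalizable_def)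
  show ne: "?W i \<noteq> {0}" if "i \<le> d" for i
    using that ev by (auto simp: eigenvalues_def set_eq_iff)
  have sub: "subspace (?W i)" for i by (rule subspace_eigenspace[OF T])
  have "eigenspace scale T e \<subseteq> (\<Sum>i\<le>d. ?W i)" for e
  proof (cases "e \<in> c ` {..d}")
    case True
    then show ?thesis using sub by (auto intro: mem_sum_sets)
  next
    case False
    then have "eigenspace scale T e = {0}" using ev by (auto simp: eigenvalues_def)
    then show ?thesis using sub by (auto intro!: subspace_0 subspace_sum_sets)
  qed
  then have "span (\<Union>e. eigenspace scale T e) \<subseteq> (\<Sum>i\<le>d. ?W i)"
    using sub by (intro span_minimal subspace_sum_sets) auto
  then have "v \<in> (\<Sum>i\<le>d. ?W i)" for v
    using diag by (auto simp: diagonalizable_def)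
  then have "\<exists>w. (\<forall>i\<le>d. w i \<in> ?W i) \<and> v = (\<Sum>i\<le>d. w i)" for v
    by (simp add: mem_sum_sets_iff Ball_def)
  moreover have "w i = 0" if w: "\<forall>i\<le>d. w i \<in> ?W i" "(\<Sum>i\<le>d. w i) = 0" "i \<le> d" for w i
    by (rule eigenvectors_independent[OF T, of c "Suc d" w])
       (use w inj in \<open>auto simp: eigenspace_def lessThan_Suc_atMost\<close>)
  ultimately show "direct_decomposition d ?W" using sub by (simp add: direct_decomposition_def)
qed

definition partial_sums :: "(nat \<Rightarrow> 'v set) \<Rightarrow> nat \<Rightarrow> 'v set" where
  "partial_sums W i = (\<Sum>k<i. W k)"

lemma mem_partial_sums_iff:
  "v \<in> partial_sums W i \<longleftrightarrow> (\<exists>w. (\<forall>k<i. w k \<in> W k) \<and> v = (\<Sum>k<i. w k))"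
  by (simp add: partial_sums_def mem_sum_sets_iff Ball_def)

text \<open>
  The steps are strict because a nonzero vector of \<open>W i\<close> lying in the sum of the earlier summands
  would have two different expansions.
\<close>

lemma flag_partial_sums:
  assumes W: "direct_decomposition d W" and ne: "\<And>i. i \<le> d \<Longrightarrow> W i \<noteq> {0}"
  shows "flag d (partial_sums W)"
proof -
  have sub: "subspace (partial_sums W i)" if "i \<le> Suc d" for i
    unfolding partial_sums_def
    using that by (intro subspace_sum_sets decomposition_subspace[OF W]) auto
  have "partial_sums W i \<subset> partial_sums W (Suc i)" if i: "i \<le> d" for i
  proof
    have subi: "subspace (W i)" using W i by (rule decomposition_subspace)
    show "partial_sums W i \<subseteq> partial_sums W (Suc i)"
      unfolding partial_sums_def sum.lessThan_Suc
      using set_plus_intro[of _ "\<Sum>k<i. W k" 0 "W i"] subspace_0[OF subi] by fastforce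
    obtain v where v: "v \<in> W i" "v \<noteq> 0" using ne[OF i] subspace_0[OF subi] by blast
    have "v \<notin> partial_sums W i"
    proof
      assume "v \<in> partial_sums W i"
      then obtain w where w: "\<forall>k<i. w k \<in> W k" "v = (\<Sum>k<i. w k)"
        by (auto simp: mem_partial_sums_iff)
      have "(\<lambda>k. if k < i then w k else 0) i = (\<lambda>k. if k = i then v else 0) i"
      proof (rule decomposition_unique[OF W _ _ _ i, where x = "\<lambda>k. if k < i then w k else 0"
              and y = "\<lambda>k. if k = i then v else 0"])
        have "(\<Sum>k\<le>d. if k < i then w k else 0) = (\<Sum>k<i. w k)"
          using i by (subst sum.If_cases) (auto intro!: sum.cong)
        then show "(\<Sum>k\<le>d. if k < i then w k else 0) = (\<Sum>k\<le>d. if k = i then v else 0)"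
          using i w by simp
      qed (use w v W in \<open>auto intro: subspace_0 decomposition_subspace\<close>)
      then show False using v by simp
    qed
    moreover have "v \<in> partial_sums W (Suc i)"
      unfolding partial_sums_def
      using v i by (intro mem_sum_sets decomposition_subspace[OF W]) auto
    ultimately show "partial_sums W i \<noteq> partial_sums W (Suc i)" by blast
  qed
  moreover have "v \<in> partial_sums W (Suc d)" for v
    using decomposition_components[OF W, of v]
    by (metis mem_partial_sums_iff lessThan_Suc_atMost less_Suc_eq_le)
  ultimately show ?thesis using sub by (auto simp: flag_def partial_sums_def)
qed

lemma lowers_partial_sums:
  assumes T: "endo T" and W: "\<And>i. i \<le> d \<Longrightarrow> subspace (W i)"
    and scales: "\<And>i w. i \<le> d \<Longrightarrow> w \<in> W i \<Longrightarrow> T w = c i *s w"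
  shows "lowers d T c (partial_sums W)"
  unfolding lowers_def
proof (intro allI impI ballI)
  fix i v assume i: "i \<le> d" and "v \<in> partial_sums W (Suc i)"
  then obtain w where w: "\<And>k. k < Suc i \<Longrightarrow> w k \<in> W k" and v: "v = (\<Sum>k<Suc i. w k)"
    by (auto simp: mem_partial_sums_iff)
  have "T v - c i *s v = (\<Sum>k<Suc i. (c k - c i) *s w k)"
    unfolding v endo_sum[OF T] scale_sum_right sum_subtractf[symmetric]
    by (rule sum.cong) (use w scales i in \<open>auto simp: scale_left_diff_distrib\<close>)
  then show "T v - c i *s v \<in> partial_sums W i"
    unfolding mem_partial_sums_iff
    using w W i by (intro exI[of _ "\<lambda>k. (c k - c i) *s w k"]) (auto intro: subspace_scale)
qed

definition raises :: "nat \<Rightarrow> ('v \<Rightarrow> 'v) \<Rightarrow> (nat \<Rightarrow> 'v set) \<Rightarrow> bool" where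
  "raises d T P \<longleftrightarrow> (\<forall>i\<le>d. \<forall>v \<in> P i. T v \<in> P (Suc i))"

definition tridiagonal :: "nat \<Rightarrow> ('v \<Rightarrow> 'v) \<Rightarrow> (nat \<Rightarrow> 'v set) \<Rightarrow> bool" where
  "tridiagonal d T W \<longleftrightarrow>
     (\<forall>i\<le>d. T ` W i \<subseteq> (\<Sum>k \<in> {k. k \<le> d \<and> i \<le> k + 1 \<and> k \<le> i + 1}. W k))"

lemma tridiagonal_raises:
  assumes T: "endo T" and W: "\<And>i. i \<le> d \<Longrightarrow> subspace (W i)" and tri: "tridiagonal d T W"
  shows "raises d T (partial_sums W)"
  unfolding raises_def
proof (intro allI impI ballI)
  fix i v assume i: "i \<le> d" and "v \<in> partial_sums W i"
  then obtain w where w: "\<forall>k<i. w k \<in> W k" and v: "v = (\<Sum>k<i. w k)"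
    by (auto simp: mem_partial_sums_iff)
  have sub: "subspace (partial_sums W (Suc i))"
    unfolding partial_sums_def using i W by (intro subspace_sum_sets) auto
  have "T (w k) \<in> partial_sums W (Suc i)" if k: "k < i" for k
  proof -
    have "(\<Sum>j \<in> {j. j \<le> d \<and> k \<le> j + 1 \<and> j \<le> k + 1}. W j) \<subseteq> partial_sums W (Suc i)"
    proof (rule sum_sets_subset[OF _ sub])
      fix j assume "j \<in> {j. j \<le> d \<and> k \<le> j + 1 \<and> j \<le> k + 1}"
      then show "W j \<subseteq> partial_sums W (Suc i)"
        unfolding partial_sums_def using k i W by (intro subsetI mem_sum_sets[of _ _ j]) auto
    qed simp
    moreover have "T ` W k \<subseteq> (\<Sum>j \<in> {j. j \<le> d \<and> k \<le> j + 1 \<and> j \<le> k + 1}. W j)"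
      using tri k i by (simp add: tridiagonal_def)
    moreover have "w k \<in> W k" using w k by blast
    ultimately show ?thesis by blast
  qed
  then show "T v \<in> partial_sums W (Suc i)"
    unfolding v endo_sum[OF T] by (intro subspace_sum[OF sub]) auto
qed

lemma tridiagonal_reverse:
  assumes "tridiagonal d T W"
  shows "tridiagonal d T (\<lambda>i. W (d - i))"
  unfolding tridiagonal_def
proof (intro allI impI)
  fix i assume i: "i \<le> d"
  have "(\<Sum>k \<in> {k. k \<le> d \<and> i \<le> k + 1 \<and> k \<le> i + 1}. W (d - k)) =
      (\<Sum>k \<in> {k. k \<le> d \<and> d - i \<le> k + 1 \<and> k \<le> d - i + 1}. W k)"
    using i by (intro sum.reindex_bij_witness[of _ "\<lambda>k. d - k" "\<lambda>k. d - k"]) auto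
  then show "T ` W (d - i) \<subseteq> (\<Sum>k \<in> {k. k \<le> d \<and> i \<le> k + 1 \<and> k \<le> i + 1}. W (d - k))"
    using assms i by (simp add: tridiagonal_def)
qed

end

section \<open>The split decomposition of a pair of flags\<close>

context operators_on_vector_space
begin

definition irreducible_pair :: "('v \<Rightarrow> 'v) \<Rightarrow> ('v \<Rightarrow> 'v) \<Rightarrow> bool" where
  "irreducible_pair A B \<longleftrightarrow>
     (\<forall>W. subspace W \<and> A ` W \<subseteq> W \<and> B ` W \<subseteq> W \<longrightarrow> W = {0} \<or> W = UNIV)"

lemma endo_image_span_subset:
  assumes T: "endo T" and "\<And>v. v \<in> S \<Longrightarrow> T v \<in> span S"
  shows "T ` span S \<subseteq> span S"
proof -
  have "subspace {v. T v \<in> span S}"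
    by (rule subspaceI)
       (auto simp: endo_zero[OF T] endo_add[OF T] endo_scale[OF T] span_zero span_add span_scale)
  then have "span S \<subseteq> {v. T v \<in> span S}" using assms(2) by (intro span_minimal) auto
  then show ?thesis by auto
qed

end

text \<open>
  The flags \<open>P\<close> and \<open>R\<close> stand for the partial sums of the eigenspaces of \<open>B\<close> and of \<open>A\<close>, each taken in
  either of its two orders.  Each operator is triangular on its own flag and moves the other flag up
  by at most one step.
\<close>

locale opposite_flags = operators_on_vector_space +
  fixes d :: nat and A B :: "'b \<Rightarrow> 'b" and \<eta> \<xi> :: "nat \<Rightarrow> 'a" and P R :: "nat \<Rightarrow> 'b set"
  assumes A: "endo A" and B: "endo B"
    and P: "flag d P" and R: "flag d R"
    and A_raises: "raises d A P" and B_lowers: "lowers d B \<xi> P"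
    and B_raises: "raises d B R" and A_lowers: "lowers d A \<eta> R"
    and irreducible: "irreducible_pair A B"
begin

text \<open>
  The split decomposition.  Since flags start at the zero subspace, \<open>P (Suc i)\<close> is spanned by the first
  \<open>i + 1\<close> eigenspaces of \<open>B\<close> and \<open>R (Suc d - i)\<close> by the first \<open>d - i + 1\<close> eigenspaces of \<open>A\<close>.
\<close>

definition U :: "nat \<Rightarrow> 'b set" where
  "U i = P (Suc i) \<inter> R (Suc d - i)"

lemma P_0: "P 0 = {0}" and R_0: "R 0 = {0}" and R_top: "R (Suc d) = UNIV"
  using P R by (simp_all add: flag_def)

lemma subspace_U: "i \<le> d \<Longrightarrow> subspace (U i)"
  unfolding U_def
  using flag_subspace[OF P, of "Suc i"] flag_subspace[OF R, of "Suc d - i"]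
  by (intro subspace_inter) simp_all

text \<open>
  On \<open>P (Suc i) \<inter> R (Suc d - (i + r))\<close> a suitable translate of \<open>A\<close> moves \<open>P\<close> up one step and \<open>R\<close> down one
  step, and a suitable translate of \<open>B\<close> does the opposite; both stay on the diagonal given by the same
  \<open>r\<close>.  Irreducibility will be applied for \<open>r = 1\<close>, where the span is too small to be everything, and
  for \<open>r = 0\<close>, where it is nonzero.
\<close>

lemma diagonal_span_invariant:
  defines "S \<equiv> \<lambda>r. span (\<Union>i\<le>d. P (Suc i) \<inter> R (Suc d - (i + r)))"
  shows "A ` S r \<subseteq> S r" and "B ` S r \<subseteq> S r"
proof -
  let ?G = "\<Union>i\<le>d. P (Suc i) \<inter> R (Suc d - (i + r))"
  show "A ` S r \<subseteq> S r"
    unfolding S_def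
  proof (rule endo_image_span_subset[OF A])
    fix x assume xG: "x \<in> ?G"
    then obtain i where i: "i \<le> d" and xP: "x \<in> P (Suc i)" and xR: "x \<in> R (Suc d - (i + r))"
      by blast
    show "A x \<in> span ?G"
    proof (cases "i + r \<le> d")
      case False
      then have "x = 0" using xR R_0 by simp
      then show ?thesis by (simp add: endo_zero[OF A] span_zero)
    next
      case True
      define j where "j = d - (i + r)"
      have j: "j \<le> d" "Suc d - (i + r) = Suc j" "Suc d - (Suc i + r) = j"
        using True by (auto simp: j_def)
      define y where "y = A x - \<eta> j *s x"
      have yR: "y \<in> R j" using A_lowers xR j unfolding lowers_def y_def by simp
      have "y \<in> span ?G"
      proof (cases "i = d")
        case True
        then have "y = 0" using yR R_0 by (simp add: j_def)
        then show ?thesis by (simp add: span_zero)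
      next
        case False
        then have le: "Suc i \<le> d" using i by simp
        have "A x \<in> P (Suc (Suc i))" using A_raises le xP unfolding raises_def by blast
        moreover have "x \<in> P (Suc (Suc i))" using flag_mono[OF P, of "Suc i" "Suc (Suc i)"] le xP by auto
        ultimately have "y \<in> P (Suc (Suc i))"
          unfolding y_def using flag_subspace[OF P, of "Suc (Suc i)"] le
          by (simp add: subspace_diff subspace_scale)
        then show ?thesis using yR j(3) le by (intro span_base UN_I[of "Suc i"]) auto
      qed
      then have "y + \<eta> j *s x \<in> span ?G" by (intro span_add span_scale span_base[OF xG])
      then show ?thesis by (simp add: y_def)
    qed
  qed
  show "B ` S r \<subseteq> S r"
    unfolding S_def
  proof (rule endo_image_span_subset[OF B])
    fix x assume xG: "x \<in> ?G"
    then obtain i where i: "i \<le> d" and xP: "x \<in> P (Suc i)" and xR: "x \<in> R (Suc d - (i + r))"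
      by blast
    define y where "y = B x - \<xi> i *s x"
    have yP: "y \<in> P i" using B_lowers xP i unfolding lowers_def y_def by blast
    have "y \<in> span ?G"
    proof (cases "i = 0 \<or> d < i + r")
      case True
      then have "y = 0"
      proof
        assume "d < i + r"
        then have "x = 0" using xR R_0 by simp
        then show ?thesis by (simp add: y_def endo_zero[OF B])
      qed (use yP P_0 in simp)
      then show ?thesis by (simp add: span_zero)
    next
      case False
      define m where "m = Suc d - (i + r)"
      have m: "m \<le> d" "Suc d - (i - 1 + r) = Suc m" using False by (auto simp: m_def)
      have "B x \<in> R (Suc m)" using B_raises m xR unfolding raises_def m_def by blast
      moreover have "x \<in> R (Suc m)" using flag_mono[OF R, of m "Suc m"] m xR by (auto simp: m_def)
      ultimately have "y \<in> R (Suc m)"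
        unfolding y_def using flag_subspace[OF R, of "Suc m"] m
        by (simp add: subspace_diff subspace_scale)
      then show ?thesis using yP m False i by (intro span_base UN_I[of "i - 1"]) auto
    qed
    then have "y + \<xi> i *s x \<in> span ?G" by (intro span_add span_scale span_base[OF xG])
    then show "B x \<in> span ?G" by (simp add: y_def)
  qed
qed

text \<open>
  The span of the diagonal \<open>r = 1\<close> lies inside the proper subspace \<open>R d\<close>, so by irreducibility it vanishes.
\<close>

lemma flags_opposite:
  assumes i: "i \<le> d" and v: "v \<in> P (Suc i)" "v \<in> R (d - i)"
  shows "v = 0"
proof -
  let ?S = "span (\<Union>i\<le>d. P (Suc i) \<inter> R (Suc d - (i + 1)))"
  have "P (Suc i) \<inter> R (Suc d - (i + 1)) \<subseteq> R d" for i
    using flag_mono[OF R, of "Suc d - (i + 1)" d] by auto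
  then have "?S \<subseteq> R d"
    using flag_subspace[OF R, of d] by (intro span_minimal) auto
  moreover have "R d \<noteq> UNIV" using R by (auto simp: flag_def)
  ultimately have "?S \<noteq> UNIV" by blast
  then have "?S = {0}"
    using irreducible diagonal_span_invariant[of 1] subspace_span unfolding irreducible_pair_def by blast
  moreover have "v \<in> ?S" using assms by (intro span_base UN_I[of i]) auto
  ultimately show ?thesis by blast
qed

text \<open>
  The part of \<open>v\<close> that should be absent lies in \<open>P (Suc i) \<inter> R (d - i)\<close> or in \<open>P i \<inter> R (Suc d - i)\<close>, both zero
  because the flags are opposite.  With these two facts each flag is recovered from \<open>U\<close>.
\<close>

lemma partial_sum_vanishes:
  assumes u: "\<And>k. k \<le> d \<Longrightarrow> u k \<in> U k" and v: "v = (\<Sum>k\<le>d. u k)" and i: "i \<le> d"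
  shows "v \<in> P (Suc i) \<Longrightarrow> v = (\<Sum>k<Suc i. u k)"
    and "v \<in> R (Suc d - i) \<Longrightarrow> (\<Sum>k<i. u k) = 0"
proof -
  have split: "v = (\<Sum>k<m. u k) + (\<Sum>k=m..d. u k)" if "m \<le> Suc d" for m
  proof -
    have "{..d} = {..<m} \<union> {m..d}" "{..<m} \<inter> {m..d} = {}" using that by auto
    then show ?thesis unfolding v by (simp add: sum.union_disjoint)
  qed
  have inP: "u k \<in> P m" if "k < m" "m \<le> Suc d" for k m
    using u[of k] that flag_mono[OF P, of "Suc k" m] unfolding U_def by auto
  have inR: "u k \<in> R (Suc d - m)" if "m \<le> k" "k \<le> d" for k m
    using u[OF that(2)] flag_mono[OF R, of "Suc d - k" "Suc d - m"] diff_le_mono2[OF that(1)]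
    unfolding U_def by auto
  have head: "(\<Sum>k<m. u k) \<in> P m" if "m \<le> Suc d" for m
    using that by (intro subspace_sum flag_subspace[OF P] inP) auto
  have tail: "(\<Sum>k=m..d. u k) \<in> R (Suc d - m)" for m
    by (intro subspace_sum flag_subspace[OF R] inR) auto
  show "v = (\<Sum>k<Suc i. u k)" if vP: "v \<in> P (Suc i)"
  proof -
    have "v - (\<Sum>k<Suc i. u k) \<in> P (Suc i)"
      using vP head[of "Suc i"] flag_subspace[OF P, of "Suc i"] i by (intro subspace_diff) auto
    moreover have "v - (\<Sum>k<Suc i. u k) = (\<Sum>k=Suc i..d. u k)" using split[of "Suc i"] i by simp
    ultimately have "(\<Sum>k=Suc i..d. u k) = 0"
      using tail[of "Suc i"] by (intro flags_opposite[OF i]) auto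
    then show ?thesis using split[of "Suc i"] i by simp
  qed
  show "(\<Sum>k<i. u k) = 0" if vR: "v \<in> R (Suc d - i)"
  proof (cases i)
    case (Suc j)
    have "v - (\<Sum>k=i..d. u k) \<in> R (Suc d - i)"
      using vR tail[of i] flag_subspace[OF R, of "Suc d - i"] by (intro subspace_diff) auto
    moreover have "v - (\<Sum>k=i..d. u k) = (\<Sum>k<i. u k)" using split[of i] i by (simp add: algebra_simps)
    ultimately show ?thesis
      using head[of i] i Suc by (intro flags_opposite[of j]) auto
  qed simp
qed

lemma decomposition_U: "direct_decomposition d U"
proof -
  have "v \<in> (\<Sum>i\<le>d. U i)" for v
  proof -
    let ?S = "span (\<Union>i\<le>d. P (Suc i) \<inter> R (Suc d - (i + 0)))"
    \<comment> \<open>The span of the diagonal \<open>r = 0\<close> contains \<open>P 1 \<inter> R (Suc d) = P 1\<close>, which is nonzero.\<close>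
    have "P 1 \<subseteq> ?S" using R_top by (auto intro!: span_base UN_I[of 0])
    moreover have "P 1 \<noteq> {0}" using P by (auto simp: flag_def)
    moreover have "0 \<in> P 1" using subspace_0[OF flag_subspace[OF P, of 1]] by simp
    ultimately have "?S \<noteq> {0}" by blast
    then have "?S = UNIV"
      using irreducible diagonal_span_invariant[of 0] subspace_span unfolding irreducible_pair_def by blast
    moreover have "(\<Union>i\<le>d. P (Suc i) \<inter> R (Suc d - (i + 0))) \<subseteq> (\<Sum>i\<le>d. U i)"
      using mem_sum_sets[of "{..d}" U, OF _ subspace_U] by (auto simp: U_def)
    then have "?S \<subseteq> (\<Sum>i\<le>d. U i)"
      by (rule span_minimal) (auto intro: subspace_sum_sets subspace_U)
    ultimately show ?thesis by blast
  qed
  then have "\<exists>w. (\<forall>i\<le>d. w i \<in> U i) \<and> v = (\<Sum>i\<le>d. w i)" for v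
    by (simp add: mem_sum_sets_iff Ball_def)
  moreover have "w i = 0" if w: "\<forall>i\<le>d. w i \<in> U i" "(\<Sum>i\<le>d. w i) = 0" and i: "i \<le> d" for w i
  proof -
    have "(0::'b) \<in> R (Suc d - i)" "(0::'b) \<in> P (Suc i)"
      using i by (auto intro!: subspace_0 flag_subspace[OF P] flag_subspace[OF R])
    then have "(\<Sum>k<i. w k) = 0" "(\<Sum>k<Suc i. w k) = 0"
      using partial_sum_vanishes[of w 0, OF _ _ i] w by auto
    then show ?thesis by simp
  qed
  ultimately show ?thesis using subspace_U by (simp add: direct_decomposition_def)
qed

lemma corresponding_map_lowers:
  fixes q :: 'a
  defines "C \<equiv> corresponding_map scale q d U"
  shows "lowers d C (\<lambda>i. q powi (int d - 2 * int i)) P"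
    and "lowers d C (\<lambda>i. q powi (2 * int i - int d)) R"
proof -
  note C = corresponding_map[OF decomposition_U, where q = q, folded C_def]
  let ?c = "\<lambda>i. q powi (int d - 2 * int i)"
  have C_sum: "C (\<Sum>k\<in>I. u k) - e *s (\<Sum>k\<in>I. u k) = (\<Sum>k\<in>I. (?c k - e) *s u k)"
    if "\<And>k. k \<in> I \<Longrightarrow> k \<le> d \<and> u k \<in> U k" for I u e
    unfolding endo_sum[OF C(1)] scale_sum_right sum_subtractf[symmetric]
    by (rule sum.cong) (use that C(2) in \<open>auto simp: scale_left_diff_distrib\<close>)
  show "lowers d C ?c P"
    unfolding lowers_def
  proof (intro allI impI ballI)
    fix i v assume i: "i \<le> d" and v: "v \<in> P (Suc i)"
    obtain u where u: "\<And>k. k \<le> d \<Longrightarrow> u k \<in> U k" and sum_u: "v = (\<Sum>k\<le>d. u k)"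
      using decomposition_components[OF decomposition_U, of v] by blast
    have v_eq: "v = (\<Sum>k<Suc i. u k)" by (rule partial_sum_vanishes(1)[OF u sum_u i v])
    have "C v - ?c i *s v = (\<Sum>k<Suc i. (?c k - ?c i) *s u k)"
      unfolding v_eq by (rule C_sum) (use u i in auto)
    also have "\<dots> = (\<Sum>k<i. (?c k - ?c i) *s u k)" by simp
    also have "\<dots> \<in> P i"
    proof (intro subspace_sum subspace_scale flag_subspace[OF P])
      fix k assume "k \<in> {..<i}"
      then show "u k \<in> P i" using u[of k] flag_mono[OF P, of "Suc k" i] i by (auto simp: U_def)
    qed (use i in auto)
    finally show "C v - ?c i *s v \<in> P i" .
  qed
  show "lowers d C (\<lambda>i. q powi (2 * int i - int d)) R"
    unfolding lowers_def
  proof (intro allI impI ballI)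
    fix j v assume j: "j \<le> d" and v: "v \<in> R (Suc j)"
    define i where "i = d - j"
    have i: "i \<le> d" "Suc d - i = Suc j" "d - i = j" and c_i: "?c i = q powi (2 * int j - int d)"
      using j by (auto simp: i_def of_nat_diff)
    obtain u where u: "\<And>k. k \<le> d \<Longrightarrow> u k \<in> U k" and sum_u: "v = (\<Sum>k\<le>d. u k)"
      using decomposition_components[OF decomposition_U, of v] by blast
    have "(\<Sum>k<i. u k) = 0"
      using partial_sum_vanishes(2)[OF u sum_u i(1)] v i(2) by simp
    moreover have "{..d} = {..<i} \<union> {i..d}" "{..<i} \<inter> {i..d} = {}" using i by auto
    ultimately have v_eq: "v = (\<Sum>k=i..d. u k)" unfolding sum_u by (simp add: sum.union_disjoint)
    have "C v - ?c i *s v = (\<Sum>k=i..d. (?c k - ?c i) *s u k)"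
      unfolding v_eq by (rule C_sum) (use u in auto)
    also have "\<dots> = (\<Sum>k=Suc i..d. (?c k - ?c i) *s u k)"
      using i by (simp add: sum.atLeast_Suc_atMost)
    also have "\<dots> \<in> R j"
    proof (intro subspace_sum subspace_scale flag_subspace[OF R])
      fix k assume k: "k \<in> {Suc i..d}"
      then have "Suc d - k \<le> j" using i by auto
      then show "u k \<in> R j"
        using u[of k] flag_mono[OF R, of "Suc d - k" j] j k by (auto simp: U_def)
    qed (use j in auto)
    finally show "C v - q powi (2 * int j - int d) *s v \<in> R j" unfolding c_i .
  qed
qed

end

section \<open>Conjugation by the diagonal map\<close>

context operators_on_vector_space
begin

text \<open>
  The vector \<open>(A - \<zeta>\<^sub>i\<^sub>+\<^sub>k\<^sub>-\<^sub>1) \<dots> (A - \<zeta>\<^sub>i) v\<close>.  On a split decomposition with eigenvalue sequence \<open>\<zeta>\<close> it is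
  the image of \<open>v \<in> U i\<close> under the \<open>k\<close>-th power of the raising map of the decomposition.
\<close>

primrec newton :: "('v \<Rightarrow> 'v) \<Rightarrow> (nat \<Rightarrow> 'f) \<Rightarrow> nat \<Rightarrow> nat \<Rightarrow> 'v \<Rightarrow> 'v" where
  "newton A \<zeta> i 0 v = v"
| "newton A \<zeta> i (Suc k) v = A (newton A \<zeta> i k v) - \<zeta> (i + k) *s newton A \<zeta> i k v"

lemma newton_shift:
  "newton A \<zeta> (Suc i) k (A v - \<zeta> i *s v) = newton A \<zeta> i (Suc k) v"
  by (induction k) simp_all

end

text \<open>
  Coefficients of the \<open>q\<^sup>2\<close>-exponential function: \<open>x\<^sup>k / (q\<^sup>2; q\<^sup>2)\<^sub>k\<close>.
\<close>

definition q_exp_coeff :: "'a::field \<Rightarrow> 'a \<Rightarrow> nat \<Rightarrow> 'a" where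
  "q_exp_coeff q x k = x ^ k / (\<Prod>j<k. 1 - q ^ (2 * Suc j))"

lemma q_exp_coeff_0 [simp]: "q_exp_coeff q x 0 = 1"
  by (simp add: q_exp_coeff_def)

lemma q_exp_coeff_Suc:
  assumes root: "\<And>n::nat. n > 0 \<Longrightarrow> q ^ n \<noteq> 1"
  shows "q_exp_coeff q x (Suc k) * (1 - q ^ (2 * Suc k)) = x * q_exp_coeff q x k"
proof -
  have cancel: "y * z / (D * e) * e = y * (z / D)" if "e \<noteq> 0" for y z D e :: 'a
    using that by simp
  have "1 - q ^ (2 * Suc k) \<noteq> 0" using root[of "2 * Suc k"] by simp
  then show ?thesis
    unfolding q_exp_coeff_def prod.lessThan_Suc power_Suc[of x] by (rule cancel)
qed

text \<open>
  Here \<open>x + x\<^sup>-\<^sup>1\<close> is the eigenvalue \<open>\<zeta>\<^sub>i\<close>, the long parenthesis is \<open>\<zeta>\<^sub>i\<^sub>+\<^sub>k\<^sub>+\<^sub>1 - \<zeta>\<^sub>i\<close>, the step from \<open>i\<close> to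
  \<open>i + 1\<close> replaces \<open>x\<close> by \<open>x / q\<^sup>2\<close>, and \<open>(x / q)\<^sup>2\<close> is the ratio \<open>t\<^sub>i\<^sub>+\<^sub>1 / t\<^sub>i\<close>.  The identity says that
  the series with these coefficients is compatible with the action of \<open>A\<close>.
\<close>

lemma q_exp_coeff_recurrence:
  fixes q x :: "'a::field"
  assumes q0: "q \<noteq> 0" and root: "\<And>n::nat. n > 0 \<Longrightarrow> q ^ n \<noteq> 1" and x: "x \<noteq> 0"
  shows "q_exp_coeff q x (Suc k) * (x / q ^ (2 * Suc k) + q ^ (2 * Suc k) / x - (x + inverse x)) +
      q_exp_coeff q x k = (x / q) ^ 2 * q_exp_coeff q (x / q ^ 2) k"
proof -
  define Q where "Q = q ^ (2 * Suc k)"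
  have Q: "Q \<noteq> 0" using q0 by (simp add: Q_def)
  have "x / Q + Q / x - (x + inverse x) = (1 - Q) * (x / Q - inverse x)"
    using x Q by (simp add: field_simps)
  then have "q_exp_coeff q x (Suc k) * (x / Q + Q / x - (x + inverse x)) =
      x * q_exp_coeff q x k * (x / Q - inverse x)"
    using q_exp_coeff_Suc[OF root, of x k] by (simp add: Q_def mult.assoc)
  also have "\<dots> = x ^ 2 / Q * q_exp_coeff q x k - q_exp_coeff q x k"
    using x Q by (simp add: field_simps power2_eq_square)
  also have "x ^ 2 / Q * q_exp_coeff q x k = (x / q) ^ 2 * q_exp_coeff q (x / q ^ 2) k"
    using q0 by (simp add: Q_def q_exp_coeff_def power_divide power_mult power2_eq_square power_mult_distrib)
  finally show ?thesis by (simp add: Q_def)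
qed

text \<open>
  The eigenvalues of \<open>A\<close> are now of the form that comes from the \<open>q\<close>-Onsager relations.  The parameter
  \<open>\<alpha>\<close> is \<open>a\<close> when \<open>R\<close> runs through the eigenspaces of \<open>A\<close> from the last to the first and \<open>a\<^sup>-\<^sup>1\<close> in the
  opposite order; reversing the order exchanges \<open>a\<close> and \<open>a\<^sup>-\<^sup>1\<close> in the formula for the eigenvalues.  The
  diagonal entries \<open>h\<close> of \<open>H\<close> on \<open>R\<close> are fixed only up to a common factor by \<open>h_ratio\<close>; this suffices
  because \<open>H\<close> is only used to transport subspaces, and it lets both orders share the same \<open>H\<close>.
\<close>

locale q_racah_flags = opposite_flags +
  fixes q \<alpha> :: 'a and H :: "'b \<Rightarrow> 'b" and h :: "nat \<Rightarrow> 'a"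
  assumes q0: "q \<noteq> 0" and root: "\<And>n::nat. n > 0 \<Longrightarrow> q ^ n \<noteq> 1" and \<alpha>: "\<alpha> \<noteq> 0"
    and \<eta>_form: "\<And>j. j \<le> d \<Longrightarrow>
      \<eta> j = \<alpha> * q powi (2 * int j - int d) + inverse \<alpha> * q powi (int d - 2 * int j)"
    and \<eta>_inj: "inj_on \<eta> {..d}"
    and H: "endo H" and H_commutes: "\<And>v. H (A v) = A (H v)" and H_lowers: "lowers d H h R"
    and h_ratio: "\<And>i. i < d \<Longrightarrow>
      h (d - Suc i) = (\<alpha> * q powi (int d - 2 * int i - 1)) ^ 2 * h (d - i)"
begin

definition C :: "'b \<Rightarrow> 'b" where "C = corresponding_map scale q d U"

definition T :: "'b \<Rightarrow> 'b" where "T v = \<alpha> *s A v - \<alpha> ^ 2 *s C v"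

text \<open>
  With this scalar the eigenvalues of \<open>A\<close>, \<open>C\<close> and \<open>T\<close> attached to \<open>U i\<close> are \<open>x i + (x i)\<^sup>-\<^sup>1\<close>, \<open>x i / \<alpha>\<close> and
  \<open>\<alpha> / x i\<close>.
\<close>

definition x :: "nat \<Rightarrow> 'a" where "x i = \<alpha> * q powi (int d - 2 * int i)"

text \<open>
  The eigenvalues of \<open>A\<close> in the order of the split decomposition, continued beyond \<open>d\<close> by the same
  formula so that identities between them need no case distinction at the end of the range.
\<close>

definition \<zeta> :: "nat \<Rightarrow> 'a" where "\<zeta> i = x i + inverse (x i)"

lemma x_nonzero: "x i \<noteq> 0"
  using q0 \<alpha> by (simp add: x_def)

lemma x_add: "x (i + k) = x i / q ^ (2 * k)"
proof -
  have "q powi (int d - 2 * int (i + k)) = q powi ((int d - 2 * int i) - int (2 * k))"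
    by (rule arg_cong[where f = "\<lambda>n. q powi n"]) simp
  also have "\<dots> = q powi (int d - 2 * int i) / q ^ (2 * k)"
    using power_int_diff[of q "int d - 2 * int i" "int (2 * k)"] q0
    by (simp only: power_int_of_nat simp_thms)
  finally show ?thesis by (simp add: x_def)
qed

lemma x_Suc: "x (Suc i) = x i / q ^ 2"
  using x_add[of i 1] by simp

lemma powi_eq_x: "q powi (int d - 2 * int i) = x i / \<alpha>" "q powi (2 * int i - int d) = \<alpha> / x i"
proof -
  show "q powi (int d - 2 * int i) = x i / \<alpha>" using \<alpha> by (simp add: x_def)
  have "q powi (2 * int i - int d) = inverse (q powi (int d - 2 * int i))"
    by (simp flip: power_int_minus)
  then show "q powi (2 * int i - int d) = \<alpha> / x i" using \<alpha> by (simp add: x_def field_simps)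
qed

lemma \<zeta>_eq_\<eta>:
  assumes i: "i \<le> d" shows "\<zeta> i = \<eta> (d - i)"
proof -
  have e: "2 * int (d - i) - int d = int d - 2 * int i" "int d - 2 * int (d - i) = 2 * int i - int d"
    using i by (simp_all add: of_nat_diff)
  have "\<eta> (d - i) = \<alpha> * (x i / \<alpha>) + inverse \<alpha> * (\<alpha> / x i)"
    using \<eta>_form[of "d - i"] unfolding e powi_eq_x by simp
  then show ?thesis using \<alpha> by (simp add: \<zeta>_def inverse_eq_divide)
qed

lemma C_endo: "endo C" and C_U: "i \<le> d \<Longrightarrow> u \<in> U i \<Longrightarrow> C u = (x i / \<alpha>) *s u"
  using corresponding_map[OF decomposition_U, where q = q]
  by (simp_all add: C_def powi_eq_x)

lemma T_endo: "endo T"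
  unfolding T_def[abs_def] by (rule endo_combination[OF A C_endo])

lemma newton_mem:
  assumes i: "i \<le> d" and u: "u \<in> U i"
  shows "(i + k \<le> d \<longrightarrow> newton A \<zeta> i k u \<in> U (i + k)) \<and> (d < i + k \<longrightarrow> newton A \<zeta> i k u = 0)"
proof (induction k)
  case 0
  then show ?case using i u by simp
next
  case (Suc k)
  let ?w = "newton A \<zeta> i k u"
  show ?case
  proof (cases "i + k \<le> d")
    case False
    then show ?thesis using Suc by (simp add: endo_zero[OF A])
  next
    case True
    then have w: "?w \<in> P (Suc (i + k))" "?w \<in> R (Suc d - (i + k))" using Suc by (auto simp: U_def)
    have "?w \<in> R (Suc (d - (i + k)))" using w True by (simp add: Suc_diff_le)
    then have r: "newton A \<zeta> i (Suc k) u \<in> R (d - (i + k))"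
      using A_lowers True unfolding lowers_def by (simp add: \<zeta>_eq_\<eta>)
    show ?thesis
    proof (cases "i + k = d")
      case True
      then show ?thesis using r R_0 by simp
    next
      case False
      then have le: "Suc (i + k) \<le> d" using True by simp
      have "A ?w \<in> P (Suc (Suc (i + k)))" using A_raises le w(1) unfolding raises_def by blast
      moreover have "?w \<in> P (Suc (Suc (i + k)))"
        using flag_mono[OF P, of "Suc (i + k)" "Suc (Suc (i + k))"] le w(1) by auto
      ultimately have "newton A \<zeta> i (Suc k) u \<in> P (Suc (Suc (i + k)))"
        using flag_subspace[OF P, of "Suc (Suc (i + k))"] le
        by (simp add: subspace_diff subspace_scale)
      then show ?thesis using r le by (simp add: U_def)
    qed
  qed
qed

lemma newton_vanishes: "i \<le> d \<Longrightarrow> u \<in> U i \<Longrightarrow> d < i + k \<Longrightarrow> newton A \<zeta> i k u = 0"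
  using newton_mem[of i u k] by simp

lemma C_newton:
  assumes "i \<le> d" "u \<in> U i"
  shows "C (newton A \<zeta> i k u) = (x (i + k) / \<alpha>) *s newton A \<zeta> i k u"
  using newton_mem[OF assms, of k] C_U[of "i + k"]
  by (cases "i + k \<le> d") (auto simp: endo_zero[OF C_endo])

lemma A_newton: "A (newton A \<zeta> i k u) = newton A \<zeta> i (Suc k) u + \<zeta> (i + k) *s newton A \<zeta> i k u"
  by simp

text \<open>
  On \<open>U (i + k)\<close> the map \<open>A\<close> is \<open>x + x\<^sup>-\<^sup>1\<close> plus raising and \<open>C\<close> is \<open>x / \<alpha>\<close>, so in \<open>\<alpha> A - \<alpha>\<^sup>2 C\<close> the terms with
  \<open>x\<close> cancel.
\<close>

lemma T_newton:
  assumes "i \<le> d" "u \<in> U i"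
  shows "T (newton A \<zeta> i k u) =
    \<alpha> *s newton A \<zeta> i (Suc k) u + (\<alpha> / x (i + k)) *s newton A \<zeta> i k u"
proof -
  have e: "\<alpha> * \<zeta> (i + k) - \<alpha> ^ 2 * (x (i + k) / \<alpha>) = \<alpha> / x (i + k)"
    using \<alpha> x_nonzero[of "i + k"] by (simp add: \<zeta>_def field_simps power2_eq_square)
  have "T (newton A \<zeta> i k u) = \<alpha> *s newton A \<zeta> i (Suc k) u +
      (\<alpha> * \<zeta> (i + k) - \<alpha> ^ 2 * (x (i + k) / \<alpha>)) *s newton A \<zeta> i k u"
    unfolding T_def C_newton[OF assms] A_newton
    by (simp only: scale_right_distrib scale_left_diff_distrib scale_scale add_diff_eq)
  then show ?thesis unfolding e .
qed

text \<open>
  Summing up to \<open>d\<close> for every \<open>i\<close> only adds terms that vanish on \<open>U i\<close>.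
\<close>

definition q_exp_series :: "nat \<Rightarrow> 'b \<Rightarrow> 'b" where
  "q_exp_series i u = (\<Sum>k\<le>d. q_exp_coeff q (x i) k *s newton A \<zeta> i k u)"

lemma sum_newton_shift:
  assumes "i \<le> d" "u \<in> U i" "c 0 = 0"
  shows "(\<Sum>k\<le>d. c k *s newton A \<zeta> i k u) = (\<Sum>k<d. c (Suc k) *s newton A \<zeta> i (Suc k) u)"
proof -
  have "(\<Sum>k\<le>d. c k *s newton A \<zeta> i k u) = (\<Sum>k<Suc d. c k *s newton A \<zeta> i k u)"
    by (simp only: lessThan_Suc_atMost)
  also have "\<dots> = c 0 *s newton A \<zeta> i 0 u + (\<Sum>k<d. c (Suc k) *s newton A \<zeta> i (Suc k) u)"
    by (rule sum.lessThan_Suc_shift)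
  finally show ?thesis using assms(3) by simp
qed

lemma sum_newton_Suc:
  assumes "i \<le> d" "u \<in> U i"
  shows "(\<Sum>k\<le>d. c k *s newton A \<zeta> i (Suc k) u) = (\<Sum>k<d. c k *s newton A \<zeta> i (Suc k) u)"
proof -
  have "newton A \<zeta> i (Suc d) u = 0" by (rule newton_vanishes[OF assms]) simp
  then show ?thesis
    unfolding lessThan_Suc_atMost[symmetric] sum.lessThan_Suc by (simp del: newton.simps)
qed

text \<open>
  Comparing coefficients of the vectors \<open>newton A \<zeta> i k u\<close>, this is the recursion
  \<open>(1 - q\<^bsup>2k\<^esup>) c\<^sub>k = x\<^sub>i c\<^sub>k\<^sub>-\<^sub>1\<close> of the \<open>q\<close>-exponential coefficients.
\<close>

lemma T_q_exp_series:
  assumes "i \<le> d" "u \<in> U i"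
  shows "T (q_exp_series i u) = (\<alpha> / x i) *s q_exp_series i u"
proof -
  let ?c = "q_exp_coeff q (x i)" and ?N = "\<lambda>k. newton A \<zeta> i k u"
  have "T (q_exp_series i u) - (\<alpha> / x i) *s q_exp_series i u =
      (\<Sum>k\<le>d. (?c k * \<alpha>) *s ?N (Suc k) + (?c k * (\<alpha> / x (i + k) - \<alpha> / x i)) *s ?N k)"
    unfolding q_exp_series_def endo_sum[OF T_endo] scale_sum_right sum_subtractf[symmetric]
    by (rule sum.cong)
       (simp_all add: endo_scale[OF T_endo] T_newton[OF assms] scale_right_distrib
          scale_left_diff_distrib right_diff_distrib mult.commute del: newton.simps)
  also have "\<dots> = (\<Sum>k<d. (?c k * \<alpha>) *s ?N (Suc k)) +
      (\<Sum>k<d. (?c (Suc k) * (\<alpha> / x (i + Suc k) - \<alpha> / x i)) *s ?N (Suc k))"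
    unfolding sum.distrib sum_newton_Suc[OF assms]
    by (subst sum_newton_shift[OF assms, of "\<lambda>k. ?c k * (\<alpha> / x (i + k) - \<alpha> / x i)"]) simp_all
  also have "\<dots> = 0"
  proof -
    have "?c k * \<alpha> + ?c (Suc k) * (\<alpha> / x (i + Suc k) - \<alpha> / x i) = 0" for k
    proof -
      have "\<alpha> / x (i + Suc k) - \<alpha> / x i = - (\<alpha> / x i) * (1 - q ^ (2 * Suc k))"
        using x_nonzero[of i] q0 unfolding x_add by (simp add: field_simps)
      then have "?c (Suc k) * (\<alpha> / x (i + Suc k) - \<alpha> / x i) =
          - (\<alpha> / x i) * (?c (Suc k) * (1 - q ^ (2 * Suc k)))"
        by (simp only: mult.left_commute)
      also have "\<dots> = - (\<alpha> / x i) * (x i * ?c k)" by (simp only: q_exp_coeff_Suc[OF root])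
      finally show ?thesis using x_nonzero[of i] by simp
    qed
    then show ?thesis
      unfolding sum.distrib[symmetric] scale_left_distrib[symmetric] by simp
  qed
  finally show ?thesis by simp
qed

text \<open>
  Passing from \<open>u\<close> to \<open>(A - \<zeta>\<^sub>i) u \<in> U (Suc i)\<close> commutes with forming the series, up to the factor by
  which the scalars of \<open>H\<close> change.
\<close>

lemma A_q_exp_series:
  assumes i: "i < d" and u: "u \<in> U i"
  shows "A (q_exp_series i u) - \<zeta> i *s q_exp_series i u =
    (x i / q) ^ 2 *s q_exp_series (Suc i) (A u - \<zeta> i *s u)"
proof -
  let ?c = "q_exp_coeff q (x i)" and ?N = "\<lambda>k. newton A \<zeta> i k u"
  have iu: "i \<le> d" "u \<in> U i" using i u by auto
  have "A (q_exp_series i u) - \<zeta> i *s q_exp_series i u =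
      (\<Sum>k\<le>d. ?c k *s ?N (Suc k) + (?c k * (\<zeta> (i + k) - \<zeta> i)) *s ?N k)"
    unfolding q_exp_series_def endo_sum[OF A] scale_sum_right sum_subtractf[symmetric]
    by (rule sum.cong)
       (simp_all only: endo_scale[OF A] A_newton scale_right_distrib scale_scale
          scale_left_diff_distrib right_diff_distrib mult.commute add_diff_eq)
  also have "\<dots> = (\<Sum>k<d. ?c k *s ?N (Suc k)) +
      (\<Sum>k<d. (?c (Suc k) * (\<zeta> (i + Suc k) - \<zeta> i)) *s ?N (Suc k))"
    unfolding sum.distrib sum_newton_Suc[OF iu]
    by (subst sum_newton_shift[OF iu, of "\<lambda>k. ?c k * (\<zeta> (i + k) - \<zeta> i)"]) simp_all
  also have "\<dots> = (\<Sum>k<d. ((x i / q) ^ 2 * q_exp_coeff q (x (Suc i)) k) *s ?N (Suc k))"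
  proof -
    have "?c k + ?c (Suc k) * (\<zeta> (i + Suc k) - \<zeta> i) = (x i / q) ^ 2 * q_exp_coeff q (x (Suc i)) k" for k
      using q_exp_coeff_recurrence[OF q0 root x_nonzero, of i k]
      unfolding \<zeta>_def x_add x_Suc by (simp add: add.commute)
    then show ?thesis unfolding sum.distrib[symmetric] scale_left_distrib[symmetric] by simp
  qed
  also have "\<dots> = (\<Sum>k\<le>d. ((x i / q) ^ 2 * q_exp_coeff q (x (Suc i)) k) *s ?N (Suc k))"
    by (rule sum_newton_Suc[OF iu, symmetric])
  also have "\<dots> = (x i / q) ^ 2 *s q_exp_series (Suc i) (A u - \<zeta> i *s u)"
    unfolding q_exp_series_def newton_shift by (simp only: scale_sum_right scale_scale)
  finally show ?thesis .
qed

text \<open>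
  An eigenvector for \<open>\<zeta>\<^sub>i = \<eta>\<^sub>d\<^sub>-\<^sub>i\<close> inside \<open>R (d - i)\<close> meets only diagonal entries different from its own
  and descends to zero.
\<close>

lemma eigenvector_below_eq_0:
  assumes i: "i \<le> d" and y: "y \<in> R (d - i)" and Ay: "A y = \<zeta> i *s y"
  shows "y = 0"
proof -
  have "\<eta> k \<noteq> \<eta> (d - i)" if "k < d - i" for k
    using inj_onD[OF \<eta>_inj, of k "d - i"] that less_imp_le[OF less_le_trans[OF that diff_le_self]] by auto
  then have "y \<in> R 0"
    using eigenvector_descends[OF R A_lowers, of y "\<eta> (d - i)" "d - i" 0] y Ay \<zeta>_eq_\<eta>[OF i] by auto
  then show ?thesis using R_0 by simp
qed

text \<open>
  Both sides agree with \<open>h (d - i) *s u\<close> modulo \<open>R (d - i)\<close>, so if their difference is an eigenvector for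
  \<open>\<zeta>\<^sub>i\<close>, it is zero.
\<close>

lemma H_eq_q_exp_seriesI:
  assumes i: "i \<le> d" and u: "u \<in> U i"
    and eig: "A (h (d - i) *s q_exp_series i u - H u) = \<zeta> i *s (h (d - i) *s q_exp_series i u - H u)"
  shows "H u = h (d - i) *s q_exp_series i u"
proof -
  let ?g = "h (d - i)"
  have sub: "subspace (R (d - i))" by (rule flag_subspace[OF R]) simp
  have uR: "u \<in> R (Suc (d - i))" using u i by (simp add: U_def Suc_diff_le)
  have Hu: "H u - ?g *s u \<in> R (d - i)" using H_lowers uR unfolding lowers_def by simp
  have "q_exp_series i u = u + (\<Sum>k<d. q_exp_coeff q (x i) (Suc k) *s newton A \<zeta> i (Suc k) u)"
    unfolding q_exp_series_def lessThan_Suc_atMost[symmetric] sum.lessThan_Suc_shift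
    by (simp del: newton.simps(2))
  moreover have "newton A \<zeta> i (Suc k) u \<in> R (d - i)" for k
  proof (cases "i + Suc k \<le> d")
    case True
    then have "newton A \<zeta> i (Suc k) u \<in> R (Suc d - (i + Suc k))"
      using newton_mem[OF i u, of "Suc k"] unfolding U_def by blast
    moreover have "R (Suc d - (i + Suc k)) \<subseteq> R (d - i)" by (rule flag_mono[OF R]) auto
    ultimately show ?thesis by blast
  next
    case False
    then have "newton A \<zeta> i (Suc k) u = 0" by (intro newton_vanishes[OF i u]) simp
    then show ?thesis using subspace_0[OF sub] by simp
  qed
  ultimately have "q_exp_series i u - u \<in> R (d - i)"
    using sub by (auto simp del: newton.simps intro!: subspace_sum subspace_scale)
  then have "?g *s (q_exp_series i u - u) - (H u - ?g *s u) \<in> R (d - i)"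
    using Hu sub by (simp add: subspace_diff subspace_scale)
  then have "?g *s q_exp_series i u - H u \<in> R (d - i)" by (simp add: scale_right_diff_distrib)
  then have "?g *s q_exp_series i u - H u = 0" by (rule eigenvector_below_eq_0[OF i _ eig])
  then show ?thesis by simp
qed

text \<open>
  Downward induction on \<open>i\<close>: since \<open>H\<close> commutes with \<open>A\<close>, applying \<open>A - \<zeta>\<^sub>i\<close> to both sides gives the
  claim for \<open>(A - \<zeta>\<^sub>i) u \<in> U (Suc i)\<close>.
\<close>

lemma H_eq_q_exp_series:
  assumes "i \<le> d" "u \<in> U i"
  shows "H u = h (d - i) *s q_exp_series i u"
  using assms
proof (induction i arbitrary: u rule: inc_induct)
  case base
  have dd: "d \<le> d" by simp
  have Au: "A u = \<zeta> d *s u" using newton_vanishes[OF dd base, of 1] by simp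
  have "newton A \<zeta> d (Suc k) u = 0" for k by (rule newton_vanishes[OF dd base]) simp
  then have "q_exp_series d u = u"
    unfolding q_exp_series_def lessThan_Suc_atMost[symmetric] sum.lessThan_Suc_shift
    by (simp del: newton.simps(2))
  then have "A (h (d - d) *s q_exp_series d u - H u) = \<zeta> d *s (h (d - d) *s q_exp_series d u - H u)"
    by (simp add: endo_diff[OF A] endo_scale[OF A] H_commutes[symmetric] Au endo_scale[OF H]
        scale_right_diff_distrib mult.commute)
  then show ?case by (rule H_eq_q_exp_seriesI[OF dd base])
next
  case (step i)
  have i: "i \<le> d" using step.hyps by simp
  let ?g = "h (d - i)" and ?X = "q_exp_series i u" and ?u' = "A u - \<zeta> i *s u"
  have u': "?u' \<in> U (Suc i)" using newton_mem[OF i step.prems, of 1] step.hyps by simp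
  have "A (H u) - \<zeta> i *s H u = H ?u'"
    by (simp add: endo_diff[OF H] endo_scale[OF H] H_commutes)
  also have "\<dots> = h (d - Suc i) *s q_exp_series (Suc i) ?u'" by (rule step.IH[OF u'])
  also have "h (d - Suc i) = (x i / q) ^ 2 * ?g"
  proof -
    have "\<alpha> * q powi (int d - 2 * int i - 1) = x i / q"
      using q0 by (simp add: x_def power_int_diff)
    then show ?thesis using h_ratio[OF step.hyps(2)] by simp
  qed
  also have "((x i / q) ^ 2 * ?g) *s q_exp_series (Suc i) ?u' =
      ?g *s ((x i / q) ^ 2 *s q_exp_series (Suc i) ?u')"
    by (simp add: mult.commute)
  also have "\<dots> = ?g *s (A ?X - \<zeta> i *s ?X)"
    by (simp only: A_q_exp_series[OF step.hyps(2) step.prems])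
  finally have "A (?g *s ?X) - A (H u) = \<zeta> i *s (?g *s ?X) - \<zeta> i *s H u"
    by (simp add: endo_scale[OF A] scale_right_diff_distrib algebra_simps)
  then show ?case
    by (intro H_eq_q_exp_seriesI[OF i step.prems]) (simp only: endo_diff[OF A] scale_right_diff_distrib)
qed

lemma T_H:
  assumes "i \<le> d" "u \<in> U i"
  shows "T (H u) = q powi (2 * int i - int d) *s H u"
  unfolding H_eq_q_exp_series[OF assms] endo_scale[OF T_endo] T_q_exp_series[OF assms] powi_eq_x
  by (simp add: mult.commute)

text \<open>
  The vectors of \<open>P (Suc i)\<close> are sums of vectors of \<open>U 0, \<dots>, U i\<close>, which \<open>H\<close> turns into eigenvectors of \<open>T\<close>.
\<close>

lemma T_lowers_image:
  "lowers d T (\<lambda>i. q powi (2 * int i - int d)) (\<lambda>i. H ` P i)"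
  unfolding lowers_def
proof (intro allI impI ballI)
  fix i w assume i: "i \<le> d" and "w \<in> H ` P (Suc i)"
  then obtain v where v: "v \<in> P (Suc i)" and w: "w = H v" by blast
  obtain u where u: "\<And>k. k \<le> d \<Longrightarrow> u k \<in> U k" and sum_u: "v = (\<Sum>k\<le>d. u k)"
    using decomposition_components[OF decomposition_U, of v] by blast
  have v_eq: "v = (\<Sum>k<Suc i. u k)" by (rule partial_sum_vanishes(1)[OF u sum_u i v])
  let ?e = "\<lambda>i. q powi (2 * int i - int d)"
  have "T w - ?e i *s w = (\<Sum>k<Suc i. (?e k - ?e i) *s H (u k))"
    unfolding w v_eq endo_sum[OF H] endo_sum[OF T_endo] scale_sum_right sum_subtractf[symmetric]
    by (rule sum.cong) (use u i in \<open>auto simp: T_H scale_left_diff_distrib\<close>)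
  also have "\<dots> = H (\<Sum>k<i. (?e k - ?e i) *s u k)"
    by (simp add: endo_sum[OF H] endo_scale[OF H])
  also have "\<dots> \<in> H ` P i"
  proof (intro imageI subspace_sum subspace_scale flag_subspace[OF P])
    fix k assume "k \<in> {..<i}"
    then show "u k \<in> P i" using u[of k] flag_mono[OF P, of "Suc k" i] i by (auto simp: U_def)
  qed (use i in auto)
  finally show "T w - ?e i *s w \<in> H ` P i" .
qed

text \<open>
  Here \<open>\<alpha> \<eta>\<^sub>i - \<alpha>\<^sup>2 q\<^bsup>2i-d\<^esup> = q\<^bsup>d-2i\<^esup>\<close>: the term of \<open>\<eta>\<^sub>i\<close> with \<open>\<alpha>\<close> cancels.
\<close>

lemma T_lowers: "lowers d T (\<lambda>i. q powi (int d - 2 * int i)) R"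
proof -
  have "lowers d T (\<lambda>i. \<alpha> * \<eta> i - \<alpha> ^ 2 * q powi (2 * int i - int d)) R"
    unfolding T_def[abs_def] C_def
    by (rule lowers_combination[OF R A_lowers corresponding_map_lowers(2)])
  then show ?thesis
    by (rule lowers_cong) (use \<alpha> in \<open>simp add: \<eta>_form algebra_simps power2_eq_square\<close>)
qed

end

section \<open>Operators satisfying the first \<open>q\<close>-Onsager relation\<close>

context operators_on_vector_space
begin

lemma bij_if_scales_summands:
  assumes W: "direct_decomposition d W" and T: "endo T"
    and scales: "\<And>i w. i \<le> d \<Longrightarrow> w \<in> W i \<Longrightarrow> T w = c i *s w" and ne: "\<And>i. i \<le> d \<Longrightarrow> c i \<noteq> 0"
  shows "bij T"
proof (rule bijI')
  fix u v
  obtain x where x: "\<And>i. i \<le> d \<Longrightarrow> x i \<in> W i" "u = (\<Sum>i\<le>d. x i)"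
    using decomposition_components[OF W, of u] by blast
  obtain y where y: "\<And>i. i \<le> d \<Longrightarrow> y i \<in> W i" "v = (\<Sum>i\<le>d. y i)"
    using decomposition_components[OF W, of v] by blast
  have cW: "c i *s w \<in> W i" if "i \<le> d" "w \<in> W i" for i w
    using subspace_scale[OF decomposition_subspace[OF W that(1)] that(2)] .
  have Tx: "T u = (\<Sum>i\<le>d. c i *s x i)" and Ty: "T v = (\<Sum>i\<le>d. c i *s y i)"
    unfolding x(2) y(2) endo_sum[OF T] by (auto intro!: sum.cong scales x(1) y(1))
  show "T u = T v \<longleftrightarrow> u = v"
  proof
    assume "T u = T v"
    then have eq: "(\<Sum>i\<le>d. c i *s x i) = (\<Sum>i\<le>d. c i *s y i)" by (simp only: Tx Ty)
    have "c i *s x i = c i *s y i" if "i \<le> d" for i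
      using decomposition_unique[OF W, of "\<lambda>i. c i *s x i" "\<lambda>i. c i *s y i", OF cW cW eq that]
        x(1) y(1) by simp
    then have "x i = y i" if "i \<le> d" for i using that ne by simp
    then show "u = v" unfolding x(2) y(2) by (intro sum.cong) auto
  qed simp
next
  fix v
  obtain y where y: "\<And>i. i \<le> d \<Longrightarrow> y i \<in> W i" "v = (\<Sum>i\<le>d. y i)"
    using decomposition_components[OF W, of v] by blast
  have "T (\<Sum>i\<le>d. inverse (c i) *s y i) = (\<Sum>i\<le>d. y i)"
    unfolding endo_sum[OF T]
    by (rule sum.cong) (simp_all add: endo_scale[OF T] scales y(1) ne)
  then show "\<exists>u. v = T u" using y(2) by metis
qed

lemma flag_image:
  assumes T: "endo T" and bij: "bij T" and P: "flag d P"
  shows "flag d (\<lambda>i. T ` P i)"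
proof -
  have "T ` P i \<subset> T ` P (Suc i)" if "i \<le> d" for i
  proof -
    have "P i \<subset> P (Suc i)" using P that by (simp add: flag_def)
    then show ?thesis using bij by (metis bij_is_inj image_strict_mono inj_on_subset top_greatest)
  qed
  then show ?thesis
    using P bij subspace_image_endo[OF T]
    by (simp add: flag_def endo_zero[OF T] bij_is_surj)
qed

lemma image_sum_sets:
  assumes T: "endo T"
  shows "T ` (\<Sum>k\<in>I. W k) = (\<Sum>k\<in>I. T ` W k)"
proof -
  have "T ` (X + Y) = T ` X + T ` Y" for X Y
    by (force simp: set_plus_def endo_add[OF T])
  moreover have "T ` 0 = 0" by (simp add: set_zero endo_zero[OF T])
  ultimately show ?thesis by (induction I rule: infinite_finite_induct) auto
qed

lemma corresponding_map_cong:
  assumes "\<And>i. i \<le> d \<Longrightarrow> W i = W' i"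
  shows "corresponding_map scale q d W = corresponding_map scale q d W'"
  unfolding corresponding_map_def using assms by (simp cong: conj_cong)

end

context q_racah_flags
begin

lemma C_goes:
  assumes "\<And>i. i \<le> d \<Longrightarrow> F i = P (Suc i)" "\<And>i. i \<le> d \<Longrightarrow> G i = R (Suc i)"
  shows "goes_from_to scale q d C F G"
  using corresponding_map_lowers[of q, folded C_def]
  by (intro goes_from_toI[OF q0 root C_endo P R] assms)

lemma T_goes:
  assumes "bij H" "\<And>i. i \<le> d \<Longrightarrow> F i = R (Suc i)" "\<And>i. i \<le> d \<Longrightarrow> G i = H ` P (Suc i)"
  shows "goes_from_to scale q d T F G"
  by (intro goes_from_toI[OF q0 root T_endo R flag_image[OF H assms(1) P]] T_lowers T_lowers_image assms)

end

text \<open>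
  The operators by which the generators \<open>A\<close> and \<open>A\<^sup>*\<close> (here \<open>B\<close>) act on an irreducible module.  The
  assumption \<open>q_Dolan_Grady\<close> is the first defining relation, multiplied out.
\<close>

locale q_racah_pair = operators_on_vector_space +
  fixes q a :: 'a and d :: nat and A B :: "'b \<Rightarrow> 'b" and \<theta> :: "nat \<Rightarrow> 'a"
  assumes q0: "q \<noteq> 0" and root: "\<And>n::nat. n > 0 \<Longrightarrow> q ^ n \<noteq> 1" and a0: "a \<noteq> 0" and d_ge: "d \<ge> 1"
    and A_diag: "diagonalizable scale A" and A_eigenvalues: "eigenvalues scale A = \<theta> ` {..d}"
    and \<theta>_form: "\<And>i. i \<le> d \<Longrightarrow>
      \<theta> i = a * q powi (int d - 2 * int i) + inverse a * q powi (2 * int i - int d)"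
    and \<theta>_inj: "inj_on \<theta> {..d}"
    and B: "endo B"
    and q_Dolan_Grady: "\<And>v. A (A (A (B v)))
      - (q ^ 2 + inverse q ^ 2 + 1) *s A (A (B (A v)))
      + (q ^ 2 + inverse q ^ 2 + 1) *s A (B (A (A v)))
      - B (A (A (A v))) + (q ^ 2 - inverse q ^ 2) ^ 2 *s (A (B v) - B (A v)) = 0"
    and irreducible: "irreducible_pair A B"
begin

definition V :: "nat \<Rightarrow> 'b set" where "V i = eigenspace scale A (\<theta> i)"

text \<open>
  The scalar with \<open>\<theta>\<^sub>i = y i + (y i)\<^sup>-\<^sup>1\<close>.
\<close>

definition y :: "nat \<Rightarrow> 'a" where "y i = a * q powi (int d - 2 * int i)"

abbreviation H :: "'b \<Rightarrow> 'b" where "H \<equiv> H_map scale q d \<theta> V"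

lemma A: "endo A"
  using A_diag by (simp add: diagonalizable_def)

lemma V_decomposition: "direct_decomposition d V" and V_nonzero: "i \<le> d \<Longrightarrow> V i \<noteq> {0}"
  using eigenspace_decomposition[OF A_diag A_eigenvalues \<theta>_inj] by (simp_all add: V_def[abs_def])

lemma \<theta>_reverse_inj: "inj_on (\<lambda>i. \<theta> (d - i)) {..d}"
proof (rule inj_onI)
  fix i j assume ij: "i \<in> {..d}" "j \<in> {..d}" and "\<theta> (d - i) = \<theta> (d - j)"
  then have "d - i = d - j" by (intro inj_onD[OF \<theta>_inj]) auto
  then show "i = j" using ij by auto
qed

lemma V_subspace: "i \<le> d \<Longrightarrow> subspace (V i)"
  by (rule decomposition_subspace[OF V_decomposition])

lemma y_nonzero: "y i \<noteq> 0"
  using q0 a0 by (simp add: y_def)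

lemma y_Suc: "y (Suc i) = y i / q ^ 2"
proof -
  have "q powi (int d - 2 * int (Suc i)) = q powi ((int d - 2 * int i) - 2)"
    by (rule arg_cong[where f = "\<lambda>n. q powi n"]) simp
  also have "\<dots> = q powi (int d - 2 * int i) / q ^ 2"
    using q0 by (simp add: power_int_diff)
  finally show ?thesis by (simp add: y_def)
qed

lemma \<theta>_eq_y: "i \<le> d \<Longrightarrow> \<theta> i = y i + inverse (y i)"
proof -
  assume i: "i \<le> d"
  have "q powi (2 * int i - int d) = inverse (q powi (int d - 2 * int i))"
    by (simp flip: power_int_minus)
  then show ?thesis using \<theta>_form[OF i] by (simp add: y_def)
qed

lemma a_sq: "a - inverse a \<noteq> 0"
proof
  assume "a - inverse a = 0"
  then have "a = inverse a" by simp
  then have "\<theta> d = \<theta> 0" using \<theta>_form[of 0] \<theta>_form[of d] by (simp add: algebra_simps)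
  then show False using inj_onD[OF \<theta>_inj, of d 0] d_ge by auto
qed

text \<open>
  As a polynomial in \<open>\<theta>\<^sub>i\<close> this has the roots \<open>y q\<^sup>2 + y\<^sup>-\<^sup>1 q\<^sup>-\<^sup>2\<close> and \<open>y q\<^sup>-\<^sup>2 + y\<^sup>-\<^sup>1 q\<^sup>2\<close> with \<open>y = y j\<close>.  The
  first is \<open>\<theta>\<^sub>j\<^sub>-\<^sub>1\<close>.  The second need not be an eigenvalue when \<open>j = d\<close>; if \<open>\<theta>\<^sub>i\<close> equals it, then either
  \<open>y i = y (j + 1)\<close>, impossible as \<open>q\<close> is not a root of unity, or \<open>y i * y j = q\<^sup>2\<close>, which forces
  \<open>\<theta>\<^sub>i\<^sub>+\<^sub>1 = \<theta>\<^sub>j\<close>.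
\<close>

lemma quadratic_factor_nonzero:
  assumes ij: "i + 2 \<le> j" "j \<le> d"
  shows "\<theta> i ^ 2 - (q ^ 2 + inverse q ^ 2) * \<theta> i * \<theta> j + \<theta> j ^ 2 + (q ^ 2 - inverse q ^ 2) ^ 2 \<noteq> 0"
    (is "?Q \<noteq> 0")
proof
  assume Q: "?Q = 0"
  obtain k where k: "j = Suc k" using ij by (cases j) auto
  have yk: "y k = y j * q ^ 2" using y_Suc[of k] q0 by (simp add: k)
  have i1: "y (Suc i) = y i / q ^ 2" by (rule y_Suc)
  have "(\<theta> i - \<theta> k) * (\<theta> i - (y j / q ^ 2 + q ^ 2 / y j)) = ?Q"
    using ij k y_nonzero[of i] y_nonzero[of j] q0
    by (simp add: \<theta>_eq_y yk field_simps power2_eq_square)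
  moreover have "\<theta> i \<noteq> \<theta> k" using inj_onD[OF \<theta>_inj, of i k] ij k by auto
  ultimately have "\<theta> i - (y j / q ^ 2 + q ^ 2 / y j) = 0" using Q by simp
  then have "(y i - y j / q ^ 2) * (y i * y j - q ^ 2) = 0"
    using y_nonzero[of i] y_nonzero[of j] q0 ij by (simp add: \<theta>_eq_y field_simps)
  moreover have "y i * y j \<noteq> q ^ 2"
  proof
    assume "y i * y j = q ^ 2"
    then have yj: "y j = q ^ 2 / y i" using y_nonzero[of i] by (simp add: field_simps)
    have "\<theta> (Suc i) = \<theta> j" using ij by (simp add: \<theta>_eq_y i1 yj add.commute)
    then show False using inj_onD[OF \<theta>_inj, of "Suc i" j] ij by auto
  qed
  moreover have "y i \<noteq> y (Suc j)"
    using powi_inj[OF q0 root, of "int d - 2 * int i" "int d - 2 * int (Suc j)"] a0 ij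
    by (auto simp: y_def)
  ultimately show False by (simp add: y_Suc)
qed

text \<open>
  On the component of \<open>B v\<close> in \<open>V i\<close>, for \<open>v \<in> V j\<close>, the left hand side of \<open>q_Dolan_Grady\<close> acts as the
  scalar \<open>(\<theta>\<^sub>i - \<theta>\<^sub>j) (\<theta>\<^sub>i\<^sup>2 - (q\<^sup>2 + q\<^sup>-\<^sup>2) \<theta>\<^sub>i \<theta>\<^sub>j + \<theta>\<^sub>j\<^sup>2 + (q\<^sup>2 - q\<^sup>-\<^sup>2)\<^sup>2)\<close>, so that component vanishes
  whenever the scalar does not.
\<close>

lemma tridiagonal_B: "tridiagonal d B V"
  unfolding tridiagonal_def
proof (intro allI impI subsetI)
  fix j w assume j: "j \<le> d" and "w \<in> B ` V j"
  then obtain v where v: "A v = \<theta> j *s v" and w: "w = B v" by (auto simp: V_def eigenspace_def)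
  obtain u where u: "\<And>i. i \<le> d \<Longrightarrow> u i \<in> V i" and Bv: "B v = (\<Sum>i\<le>d. u i)"
    using decomposition_components[OF V_decomposition, of "B v"] by blast
  have Au: "A (u i) = \<theta> i *s u i" if "i \<le> d" for i using u[OF that] by (simp add: V_def eigenspace_def)
  let ?s = "q ^ 2 + inverse q ^ 2" and ?r = "(q ^ 2 - inverse q ^ 2) ^ 2"
  let ?p = "\<lambda>i. (\<theta> i - \<theta> j) * (\<theta> i ^ 2 - ?s * \<theta> i * \<theta> j + \<theta> j ^ 2 + ?r)"
  have "A (A (A (B v))) - (?s + 1) *s \<theta> j *s A (A (B v)) + (?s + 1) *s \<theta> j *s \<theta> j *s A (B v)
      - \<theta> j *s \<theta> j *s \<theta> j *s B v + ?r *s (A (B v) - \<theta> j *s B v) = 0"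
    using q_Dolan_Grady[of v] by (simp only: v endo_scale[OF A] endo_scale[OF B])
  then have DG: "A (A (A (B v))) - (\<theta> j * (?s + 1)) *s A (A (B v))
      + (\<theta> j ^ 2 * (?s + 1) + ?r) *s A (B v) - (\<theta> j ^ 3 + \<theta> j * ?r) *s B v = 0"
    by (simp add: algebra_simps power2_eq_square power3_eq_cube)
  have A1: "A (\<Sum>i\<le>d. u i) = (\<Sum>i\<le>d. \<theta> i *s u i)"
    unfolding endo_sum[OF A] by (rule sum.cong) (auto simp: Au)
  have A2: "A (\<Sum>i\<le>d. \<theta> i *s u i) = (\<Sum>i\<le>d. \<theta> i ^ 2 *s u i)"
    unfolding endo_sum[OF A] by (rule sum.cong) (auto simp: Au endo_scale[OF A] power2_eq_square)
  have A3: "A (\<Sum>i\<le>d. \<theta> i ^ 2 *s u i) = (\<Sum>i\<le>d. \<theta> i ^ 3 *s u i)"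
    unfolding endo_sum[OF A]
    by (rule sum.cong) (auto simp: Au endo_scale[OF A] power3_eq_cube power2_eq_square)
  have "(\<Sum>i\<le>d. ?p i *s u i) = (\<Sum>i\<le>d. \<theta> i ^ 3 *s u i - (\<theta> j * (?s + 1)) *s \<theta> i ^ 2 *s u i
      + (\<theta> j ^ 2 * (?s + 1) + ?r) *s \<theta> i *s u i - (\<theta> j ^ 3 + \<theta> j * ?r) *s u i)"
  proof (rule sum.cong)
    fix i
    have "?p i = \<theta> i ^ 3 - (\<theta> j * (?s + 1)) * \<theta> i ^ 2 + (\<theta> j ^ 2 * (?s + 1) + ?r) * \<theta> i
        - (\<theta> j ^ 3 + \<theta> j * ?r)"
      by (simp add: algebra_simps power2_eq_square power3_eq_cube)
    then show "?p i *s u i = \<theta> i ^ 3 *s u i - (\<theta> j * (?s + 1)) *s \<theta> i ^ 2 *s u i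
      + (\<theta> j ^ 2 * (?s + 1) + ?r) *s \<theta> i *s u i - (\<theta> j ^ 3 + \<theta> j * ?r) *s u i"
      by (simp only: scale_left_diff_distrib scale_left_distrib scale_scale)
  qed simp
  also have "\<dots> = 0"
    using DG unfolding Bv A1 A2 A3
    unfolding scale_sum_right sum_subtractf[symmetric] sum.distrib[symmetric] .
  finally have sum0: "(\<Sum>i\<le>d. ?p i *s u i) = (\<Sum>i\<le>d. 0)" by simp
  have u0: "u i = 0" if i: "i \<le> d" and far: "\<not> (j \<le> i + 1 \<and> i \<le> j + 1)" for i
  proof -
    have "?p i *s u i = 0"
      using decomposition_unique[OF V_decomposition _ _ sum0 i] u
        decomposition_subspace[OF V_decomposition] by (simp add: subspace_scale subspace_0)
    moreover have "\<theta> i - \<theta> j \<noteq> 0" using inj_onD[OF \<theta>_inj, of i j] i j far by auto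
    moreover have "\<theta> i ^ 2 - ?s * \<theta> i * \<theta> j + \<theta> j ^ 2 + ?r \<noteq> 0"
    proof (cases "i + 2 \<le> j")
      case True
      then show ?thesis using quadratic_factor_nonzero j by blast
    next
      case False
      then have "j + 2 \<le> i" using far by auto
      then have "\<theta> j ^ 2 - ?s * \<theta> j * \<theta> i + \<theta> i ^ 2 + ?r \<noteq> 0"
        using quadratic_factor_nonzero i by blast
      then show ?thesis by (simp add: algebra_simps)
    qed
    ultimately show ?thesis by simp
  qed
  have "w = (\<Sum>i \<in> {k. k \<le> d \<and> j \<le> k + 1 \<and> k \<le> j + 1}. u i)"
    unfolding w Bv by (rule sum.mono_neutral_right) (use u0 in auto)
  then show "w \<in> (\<Sum>k \<in> {k. k \<le> d \<and> j \<le> k + 1 \<and> k \<le> j + 1}. V k)"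
    using u by (auto simp: mem_sum_sets_iff)
qed

lemma t_coeff_Suc:
  assumes k: "k < d"
  shows "t_coeff q \<theta> (Suc k) = (y k / q) ^ 2 * t_coeff q \<theta> k"
proof -
  have q1: "q ^ 2 \<noteq> 1" "q ^ 4 \<noteq> 1" using root by simp_all
  have d1: "q - inverse q \<noteq> 0"
    using q1(1) q0 by (simp add: field_simps power2_eq_square)
  have d2: "q ^ 2 - inverse q ^ 2 \<noteq> 0"
  proof
    assume "q ^ 2 - inverse q ^ 2 = 0"
    then have "q ^ 2 * q ^ 2 = inverse q ^ 2 * q ^ 2" by simp
    then show False using q1(2) q0 by (simp add: power_inverse flip: power_add)
  qed
  have \<theta>1: "\<theta> (Suc k) = y k / q ^ 2 + q ^ 2 / y k"
    using k by (simp add: \<theta>_eq_y y_Suc field_simps)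
  have \<theta>0: "\<theta> k = y k + inverse (y k)" using k by (simp add: \<theta>_eq_y)
  have n1: "\<theta> k - \<theta> (Suc k) = (q - inverse q) * (y k / q - q / y k)"
    unfolding \<theta>0 \<theta>1 using q0 y_nonzero[of k] by (simp add: field_simps power2_eq_square)
  have n2: "q * \<theta> k - inverse q * \<theta> (Suc k) = (q ^ 2 - inverse q ^ 2) * (y k / q)"
    unfolding \<theta>0 \<theta>1 using q0 y_nonzero[of k] by (simp add: field_simps power2_eq_square)
  have "t_entry q (\<theta> k) (\<theta> (Suc k)) = 1 + (y k / q - q / y k) * (y k / q)"
    unfolding t_entry_def n1 n2 using d1 d2 by simp
  also have "\<dots> = (y k / q) ^ 2"
    using q0 y_nonzero[of k] by (simp add: field_simps power2_eq_square)
  finally show ?thesis by (simp add: t_coeff_def mult.commute)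
qed

lemma t_coeff_nonzero: "k \<le> d \<Longrightarrow> t_coeff q \<theta> k \<noteq> 0"
proof (induction k)
  case (Suc k)
  then show ?case using t_coeff_Suc[of k] y_nonzero[of k] q0 by simp
qed (simp add: t_coeff_def)

lemma H_endo: "endo H" and H_V: "j \<le> d \<Longrightarrow> v \<in> V j \<Longrightarrow> H v = t_coeff q \<theta> j *s v"
  using H_map_decomposition[OF V_decomposition] by blast+

lemma H_bij: "bij H"
  by (rule bij_if_scales_summands[OF V_decomposition H_endo H_V t_coeff_nonzero])

lemma H_commutes: "H (A v) = A (H v)"
proof -
  obtain u where u: "\<And>i. i \<le> d \<Longrightarrow> u i \<in> V i" and v: "v = (\<Sum>i\<le>d. u i)"
    using decomposition_components[OF V_decomposition, of v] by blast
  have "A (u i) = \<theta> i *s u i" if "i \<le> d" for i using u[OF that] by (simp add: V_def eigenspace_def)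
  then show ?thesis
    unfolding v endo_sum[OF A] endo_sum[OF H_endo]
    by (intro sum.cong) (simp_all add: H_V u endo_scale[OF A] endo_scale[OF H_endo] mult.commute)
qed

text \<open>
  The flag \<open>P\<close> will be built from the eigenspaces of \<open>B\<close> in either of their two orders.  It is paired
  with the eigenspaces of \<open>A\<close> in decreasing order of index and parameter \<open>a\<close>, which gives the map \<open>K\<close>, and
  in increasing order and parameter \<open>a\<^sup>-\<^sup>1\<close>, which gives the map \<open>Bm\<close>.
\<close>

context
  fixes P :: "nat \<Rightarrow> 'b set" and \<xi> :: "nat \<Rightarrow> 'a"
  assumes P: "flag d P" and A_raises: "raises d A P" and B_lowers: "lowers d B \<xi> P"
begin

interpretation down: q_racah_flags scale d A B "\<lambda>i. \<theta> (d - i)" \<xi> P "partial_sums (\<lambda>i. V (d - i))"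
  q a H "\<lambda>i. t_coeff q \<theta> (d - i)"
proof (intro q_racah_flags.intro opposite_flags.intro opposite_flags_axioms.intro
    q_racah_flags_axioms.intro)
  show "operators_on_vector_space scale" by (rule operators_on_vector_space_axioms)
  show "endo A" "endo B" "flag d P" "raises d A P" "lowers d B \<xi> P" "irreducible_pair A B"
    "q \<noteq> 0" "a \<noteq> 0" "endo H" "\<And>v. H (A v) = A (H v)" "\<And>n::nat. n > 0 \<Longrightarrow> q ^ n \<noteq> 1"
    by (fact A B P A_raises B_lowers irreducible q0 a0 H_endo H_commutes root)+
  show "flag d (partial_sums (\<lambda>i. V (d - i)))"
    by (rule flag_partial_sums[OF decomposition_reverse[OF V_decomposition]]) (simp add: V_nonzero)
  show "raises d B (partial_sums (\<lambda>i. V (d - i)))"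
    by (rule tridiagonal_raises[OF B _ tridiagonal_reverse[OF tridiagonal_B]]) (simp add: V_subspace)
  show "lowers d A (\<lambda>i. \<theta> (d - i)) (partial_sums (\<lambda>i. V (d - i)))"
    by (rule lowers_partial_sums[OF A]) (simp_all add: V_subspace, simp add: V_def eigenspace_def)
  show "lowers d H (\<lambda>i. t_coeff q \<theta> (d - i)) (partial_sums (\<lambda>i. V (d - i)))"
    by (rule lowers_partial_sums[OF H_endo]) (simp_all add: V_subspace H_V)
  show "inj_on (\<lambda>i. \<theta> (d - i)) {..d}" by (rule \<theta>_reverse_inj)
  show "\<theta> (d - j) = a * q powi (2 * int j - int d) + inverse a * q powi (int d - 2 * int j)"
    if "j \<le> d" for j
    using that \<theta>_form[of "d - j"] by (simp add: of_nat_diff algebra_simps)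
  show "t_coeff q \<theta> (d - (d - Suc i)) =
      (a * q powi (int d - 2 * int i - 1)) ^ 2 * t_coeff q \<theta> (d - (d - i))" if i: "i < d" for i
  proof -
    have "a * q powi (int d - 2 * int i - 1) = y i / q"
      using q0 by (simp add: y_def power_int_diff)
    then show ?thesis using t_coeff_Suc[OF i] i by simp
  qed
qed

interpretation up: q_racah_flags scale d A B \<theta> \<xi> P "partial_sums V" q "inverse a" H "t_coeff q \<theta>"
proof (intro q_racah_flags.intro opposite_flags.intro opposite_flags_axioms.intro
    q_racah_flags_axioms.intro)
  show "operators_on_vector_space scale" by (rule operators_on_vector_space_axioms)
  show "endo A" "endo B" "flag d P" "raises d A P" "lowers d B \<xi> P" "irreducible_pair A B"
    "q \<noteq> 0" "endo H" "\<And>v. H (A v) = A (H v)" "\<And>n::nat. n > 0 \<Longrightarrow> q ^ n \<noteq> 1" "inj_on \<theta> {..d}"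
    by (fact A B P A_raises B_lowers irreducible q0 H_endo H_commutes root \<theta>_inj)+
  show "inverse a \<noteq> 0" using a0 by simp
  show "flag d (partial_sums V)"
    by (rule flag_partial_sums[OF V_decomposition V_nonzero])
  show "raises d B (partial_sums V)"
    by (rule tridiagonal_raises[OF B V_subspace tridiagonal_B])
  show "lowers d A \<theta> (partial_sums V)"
    by (rule lowers_partial_sums[OF A]) (simp_all add: V_subspace, simp add: V_def eigenspace_def)
  show "lowers d H (t_coeff q \<theta>) (partial_sums V)"
    by (rule lowers_partial_sums[OF H_endo]) (simp_all add: V_subspace H_V)
  show "\<theta> j = inverse a * q powi (2 * int j - int d) + inverse (inverse a) * q powi (int d - 2 * int j)"
    if "j \<le> d" for j
    using \<theta>_form[OF that] by simp
  show "t_coeff q \<theta> (d - Suc i) =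
      (inverse a * q powi (int d - 2 * int i - 1)) ^ 2 * t_coeff q \<theta> (d - i)" if i: "i < d" for i
  proof -
    define k where "k = d - Suc i"
    have k: "k < d" "d - i = Suc k" using i by (auto simp: k_def)
    have "q powi (int d - 2 * int i - 1) = q powi (- (int d - 2 * int k - 1))"
      using i by (intro arg_cong[where f = "\<lambda>n. q powi n"]) (simp add: k_def of_nat_diff)
    also have "\<dots> = inverse (q powi (int d - 2 * int k - 1))" by (rule power_int_minus)
    also have "q powi (int d - 2 * int k - 1) = y k / a / q"
      using q0 a0 by (simp add: y_def power_int_diff)
    finally have "inverse a * q powi (int d - 2 * int i - 1) = inverse (y k / q)"
      using a0 by (simp add: field_simps)
    then show ?thesis
      using t_coeff_Suc[OF k(1)] y_nonzero[of k] q0 unfolding k(2) k_def[symmetric]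
      by (simp add: power_inverse flip: power_mult_distrib)
  qed
qed

text \<open>
  For the last map: on \<open>P\<close> the two split maps have the same diagonal entries, and so do the two
  associated maps \<open>T\<close> on the image of \<open>P\<close> under \<open>H\<close>.  As \<open>a K - a\<^sup>-\<^sup>1 Bm = a T\<^sub>u\<^sub>p - a\<^sup>-\<^sup>1 T\<^sub>d\<^sub>o\<^sub>w\<^sub>n\<close>, the
  normalized combination is triangular on both flags with those same entries.
\<close>

lemma split_maps_go:
  fixes K Bm :: "'b \<Rightarrow> 'b" and F G :: "nat \<Rightarrow> 'b set"
  assumes K: "K = corresponding_map scale q d (\<lambda>i. F i \<inter> (\<Sum>k=i..d. V k))"
    and Bm: "Bm = corresponding_map scale q d (\<lambda>i. F i \<inter> (\<Sum>k\<le>d-i. V k))"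
    and F: "\<And>i. i \<le> d \<Longrightarrow> F i = P (Suc i)" and G: "\<And>i. i \<le> d \<Longrightarrow> G i = H ` P (Suc i)"
  shows "goes_from_to scale q d Bm F (flag_first V)"
    and "goes_from_to scale q d K F (flag_last d V)"
    and "goes_from_to scale q d (\<lambda>v. inverse a *s A v - inverse a ^ 2 *s Bm v) (flag_first V) G"
    and "goes_from_to scale q d (\<lambda>v. a *s A v - a ^ 2 *s K v) (flag_last d V) G"
    and "goes_from_to scale q d
      (\<lambda>v. inverse (a - inverse a) *s (a *s K v - inverse a *s Bm v)) F G"
proof -
  have first: "flag_first V i = partial_sums V (Suc i)" for i
    by (simp add: flag_first_def partial_sums_def lessThan_Suc_atMost)
  have last: "flag_last d V i = partial_sums (\<lambda>i. V (d - i)) (Suc i)" if "i \<le> d" for i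
    using sum_atMost_reverse[OF that, of V]
    by (simp add: flag_last_def partial_sums_def lessThan_Suc_atMost)
  have K_eq: "K = down.C"
    unfolding K down.C_def
  proof (rule corresponding_map_cong)
    fix i assume i: "i \<le> d"
    have "(\<Sum>k=d-(d-i)..d. V k) = (\<Sum>k\<le>d-i. V (d - k))" by (rule sum_atMost_reverse) simp
    then show "F i \<inter> (\<Sum>k=i..d. V k) = down.U i"
      using i F by (simp add: down.U_def partial_sums_def Suc_diff_le lessThan_Suc_atMost)
  qed
  have Bm_eq: "Bm = up.C"
    unfolding Bm up.C_def
    by (rule corresponding_map_cong)
       (simp add: F up.U_def partial_sums_def Suc_diff_le lessThan_Suc_atMost)
  show "goes_from_to scale q d Bm F (flag_first V)"
    unfolding Bm_eq by (rule up.C_goes[OF F first])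
  show "goes_from_to scale q d K F (flag_last d V)"
    unfolding K_eq by (rule down.C_goes[OF F last])
  show "goes_from_to scale q d (\<lambda>v. inverse a *s A v - inverse a ^ 2 *s Bm v) (flag_first V) G"
    unfolding Bm_eq up.T_def[symmetric] by (rule up.T_goes[OF H_bij first G])
  show "goes_from_to scale q d (\<lambda>v. a *s A v - a ^ 2 *s K v) (flag_last d V) G"
    unfolding K_eq down.T_def[symmetric] by (rule down.T_goes[OF H_bij last G])
  let ?M = "\<lambda>v. inverse (a - inverse a) *s (a *s K v - inverse a *s Bm v)"
  define x y where "x = inverse (a - inverse a) * a" and "y = inverse (a - inverse a) * inverse a"
  have xy: "x - y = 1" using a_sq by (simp add: x_def y_def flip: right_diff_distrib)
  have M1: "?M = (\<lambda>v. x *s down.C v - y *s up.C v)"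
    by (simp add: K_eq Bm_eq x_def y_def scale_right_diff_distrib)
  have M2: "?M = (\<lambda>v. x *s up.T v - y *s down.T v)"
  proof
    fix v
    have "a *s up.T v - inverse a *s down.T v = a *s K v - inverse a *s Bm v"
      using a0 by (simp add: up.T_def down.T_def K_eq Bm_eq scale_right_diff_distrib power2_eq_square
          mult.assoc[symmetric])
    then have "?M v = inverse (a - inverse a) *s (a *s up.T v - inverse a *s down.T v)" by simp
    then show "?M v = x *s up.T v - y *s down.T v"
      by (simp add: x_def y_def scale_right_diff_distrib)
  qed
  show "goes_from_to scale q d ?M F G"
  proof (rule goes_from_toI[OF q0 root _ P flag_image[OF H_endo H_bij P]])
    show "endo ?M" unfolding M1 by (rule endo_combination[OF down.C_endo up.C_endo])
    have "lowers d ?M (\<lambda>i. x * q powi (int d - 2 * int i) - y * q powi (int d - 2 * int i)) P"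
      unfolding M1 down.C_def up.C_def
      by (rule lowers_combination[OF P down.corresponding_map_lowers(1) up.corresponding_map_lowers(1)])
    then show "lowers d ?M (\<lambda>i. q powi (int d - 2 * int i)) P"
      by (simp add: xy flip: left_diff_distrib)
    have "lowers d ?M (\<lambda>i. x * q powi (2 * int i - int d) - y * q powi (2 * int i - int d)) (\<lambda>i. H ` P i)"
      unfolding M2
      by (rule lowers_combination[OF flag_image[OF H_endo H_bij P] up.T_lowers_image down.T_lowers_image])
    then show "lowers d ?M (\<lambda>i. q powi (2 * int i - int d)) (\<lambda>i. H ` P i)"
      by (simp add: xy flip: left_diff_distrib)
  qed (simp_all add: F G root)
qed

end
end

section \<open>From modules to operators\<close>

lemma ring_free_ring: "ring (free_ring :: 'f::field free_algebra ring)"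
proof (rule ringI)
  show "abelian_group (free_ring :: 'f free_algebra ring)"
  proof (rule abelian_groupI)
    show "\<exists>y\<in>carrier free_ring. y \<oplus>\<^bsub>free_ring\<^esub> x = \<zero>\<^bsub>free_ring\<^esub>" for x :: "'f free_algebra"
      by (rule bexI[of _ "- x"]) (simp_all add: free_ring_def)
  qed (simp_all add: free_ring_def add.assoc add.commute)
  show "Group.monoid (free_ring :: 'f free_algebra ring)"
    by (rule monoidI) (simp_all add: free_ring_def mult.assoc)
qed (simp_all add: free_ring_def distrib_left distrib_right)

lemma ideal_qOnsager_ideal: "ideal (qOnsager_ideal q) free_ring"
  unfolding qOnsager_ideal_def by (rule ring.genideal_ideal[OF ring_free_ring]) (simp add: free_ring_def)

lemma relator_in_qOnsager_ideal:
  "qOnsager_relator q (free_gen GenA) (free_gen GenAstar) \<in> qOnsager_ideal q"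
  unfolding qOnsager_ideal_def
  by (rule subsetD[OF ring.genideal_self[OF ring_free_ring]]) (simp_all add: free_ring_def)

text \<open>
  Every element is a sum of scalar multiples of words, and words are products of generators.
\<close>

lemma free_algebra_induct [case_names scalar gen add mult]:
  assumes scalar: "\<And>c. Q (free_scalar c)" and gen: "\<And>g. Q (free_gen g)"
    and add: "\<And>f g. Q f \<Longrightarrow> Q g \<Longrightarrow> Q (f + g)" and mult: "\<And>f g. Q f \<Longrightarrow> Q g \<Longrightarrow> Q (f * g)"
  shows "Q f"
proof -
  have monic: "Q (Poly_Mapping.single (Word gs) 1)" for gs
  proof (induction gs)
    case Nil
    then show ?case using scalar[of 1] by (simp add: free_scalar_def zero_word_def)
  next
    case (Cons g gs)
    have "Poly_Mapping.single (Word (g # gs)) (1::'a) = free_gen g * Poly_Mapping.single (Word gs) 1"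
      by (simp add: free_gen_def mult_single plus_word_def)
    then show ?case using mult[OF gen Cons.IH] by simp
  qed
  have single: "Q (Poly_Mapping.single w c)" for w c
  proof -
    have "Poly_Mapping.single w c = free_scalar c * Poly_Mapping.single (Word (letters w)) 1"
      by (simp add: free_scalar_def mult_single)
    then show ?thesis by (metis mult scalar monic)
  qed
  show ?thesis
  proof (induction f rule: update_induct)
    case const
    then show ?case using scalar[of 0] by (simp add: free_scalar_def)
  next
    case (update f w c)
    have "Poly_Mapping.update w c f = f + Poly_Mapping.single w c"
      using update(1) by (intro poly_mapping_eqI) (auto simp: lookup_update lookup_add lookup_single
          in_keys_iff when_def)
    then show ?case using add[OF update(3) single] by simp
  qed
qed

locale qOnsager_action = operators_on_vector_space +
  fixes q :: 'a and \<rho> :: "'a free_algebra set \<Rightarrow> 'b \<Rightarrow> 'b"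
  assumes hom: "\<rho> \<in> ring_hom (qOnsager q) (End_ring scale)"
    and scalar: "\<And>c. \<rho> (qOnsager_class q (free_scalar c)) = scale c"
begin

definition act :: "'a free_algebra \<Rightarrow> 'b \<Rightarrow> 'b" where
  "act f = \<rho> (qOnsager_class q f)"

lemma act_hom: "act \<in> ring_hom free_ring (End_ring scale)"
proof -
  have "qOnsager_class q \<in> ring_hom free_ring (qOnsager q)"
    using ideal.rcos_ring_hom[OF ideal_qOnsager_ideal[of q]]
    unfolding qOnsager_def by (simp add: qOnsager_class_def[abs_def])
  then have "\<rho> \<circ> qOnsager_class q \<in> ring_hom free_ring (End_ring scale)"
    using hom by (rule ring_hom_trans)
  then show ?thesis by (simp add: act_def[abs_def] comp_def)
qed

lemma act_endo: "endo (act f)"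
  using ring_hom_closed[OF act_hom, of f] by (simp add: free_ring_def End_ring_def)

lemma act_add: "act (f + g) v = act f v + act g v"
  using ring_hom_add[OF act_hom, of f g] by (simp add: free_ring_def End_ring_def)

lemma act_mult: "act (f * g) v = act f (act g v)"
  using ring_hom_mult[OF act_hom, of f g] by (simp add: free_ring_def End_ring_def)

lemma act_scalar: "act (free_scalar c) v = c *s v"
  by (simp add: act_def scalar)

lemma act_diff: "act (f - g) v = act f v - act g v"
  using act_add[of "f - g" g v] by simp

lemma act_relator: "act (qOnsager_relator q (free_gen GenA) (free_gen GenAstar)) v = 0"
proof -
  let ?I = "qOnsager_ideal q"
  have class_eq: "qOnsager_class q f = ?I" if "f \<in> ?I" for f
    unfolding qOnsager_class_def
    by (rule ring.a_rcos_zero[OF ring_free_ring ideal_qOnsager_ideal that])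
  have "0 \<in> ?I"
    using additive_subgroup.zero_closed[OF ideal.axioms(1)[OF ideal_qOnsager_ideal[of q]]]
    by (simp add: free_ring_def)
  then have "qOnsager_class q (qOnsager_relator q (free_gen GenA) (free_gen GenAstar)) =
      qOnsager_class q (free_scalar 0)"
    using class_eq relator_in_qOnsager_ideal[of q] by (simp add: free_scalar_def)
  then show ?thesis using act_scalar[of 0 v] by (simp add: act_def)
qed

lemma act_q_Dolan_Grady:
  assumes q0: "q \<noteq> 0"
  defines "A \<equiv> act (free_gen GenA)" and "B \<equiv> act (free_gen GenAstar)"
  shows "A (A (A (B v))) - (q ^ 2 + inverse q ^ 2 + 1) *s A (A (B (A v)))
      + (q ^ 2 + inverse q ^ 2 + 1) *s A (B (A (A v)))
      - B (A (A (A v))) + (q ^ 2 - inverse q ^ 2) ^ 2 *s (A (B v) - B (A v)) = 0"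
proof -
  have A: "endo A" unfolding A_def by (rule act_endo)
  have qi: "q * inverse q = 1" "inverse q * q = 1" using q0 by simp_all
  have *: "A (inverse q *s A (q *s A (B v) - inverse q *s B (A v)) -
        q *s (q *s A (B (A v)) - inverse q *s B (A (A v)))) -
      (inverse q *s A (q *s A (B (A v)) - inverse q *s B (A (A v))) -
        q *s (q *s A (B (A (A v))) - inverse q *s B (A (A (A v))))) -
      (q ^ 2 - inverse q ^ 2) ^ 2 *s (B (A v) - A (B v)) = 0"
    using act_relator[of v]
    by (simp only: qOnsager_relator_def comm_def q_comm_def act_diff act_mult act_scalar
        A_def[symmetric] B_def[symmetric] inverse_inverse_eq)
  show ?thesis
    using *
    by (simp only: endo_diff[OF A] endo_scale[OF A] scale_right_diff_distrib scale_scale qi scale_one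
        scale_left_distrib power2_eq_square) (simp add: algebra_simps)
qed

text \<open>
  Invariance under the generators propagates to the whole free algebra, hence to its quotient.
\<close>

lemma invariant_imp_submodule:
  assumes "subspace W" "act (free_gen GenA) ` W \<subseteq> W" "act (free_gen GenAstar) ` W \<subseteq> W"
  shows "qOnsager_submodule scale q \<rho> W"
proof -
  have W: "act f ` W \<subseteq> W" for f
  proof (induction f rule: free_algebra_induct)
    case (gen g)
    then show ?case using assms(2,3) by (cases g) simp_all
  qed (use assms(1) in \<open>auto simp: act_scalar act_add act_mult image_subset_iff
         intro: subspace_scale subspace_add\<close>)
  have "\<exists>f. X = qOnsager_class q f" if "X \<in> carrier (qOnsager q)" for X
    using that by (auto simp: qOnsager_def qOnsager_class_def FactRing_def A_RCOSETS_def')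
  then show ?thesis using W assms(1) unfolding qOnsager_submodule_def act_def by metis
qed

end


section \<open>The linear maps between the six flags\<close>

theorem theorem8p3:
  fixes scale :: "'f::field \<Rightarrow> 'v::ab_group_add \<Rightarrow> 'v"
    and q a :: 'f
    and \<rho> :: "'f free_algebra set \<Rightarrow> 'v \<Rightarrow> 'v"
    and d :: nat
    and \<theta> \<theta>s :: "nat \<Rightarrow> 'f"
    and V Vs Vm :: "nat \<Rightarrow> 'v set"
    and A As K B Kd Bd M Md :: "'v \<Rightarrow> 'v"
  assumes q_nz: "q \<noteq> 0"
    and q_not_root: "\<And>n::nat. n > 0 \<Longrightarrow> q ^ n \<noteq> 1"
    and irred: "irreducible_qOnsager_module scale q \<rho>"
    and fin_dim: "\<exists>Basis. finite_dimensional_vector_space scale Basis"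
    and dim_ge: "vector_space.dim scale (UNIV :: 'v set) \<ge> 2"
    and A_def: "A = \<rho> (qOnsager_gen q GenA)"
    and As_def: "As = \<rho> (qOnsager_gen q GenAstar)"
    and A_diag: "diagonalizable scale A"
    and As_diag: "diagonalizable scale As"
    and d_ge: "d \<ge> 1"
    and a_nz: "a \<noteq> 0"
    and \<theta>_form: "\<And>i. i \<le> d \<Longrightarrow>
        \<theta> i = a * q powi (int d - 2 * int i) + inverse a * q powi (2 * int i - int d)"
    and \<theta>_inj: "inj_on \<theta> {..d}"
    and \<theta>_eigenvalues: "eigenvalues scale A = \<theta> ` {..d}"
    and V_def: "V = (\<lambda>i. eigenspace scale A (\<theta> i))"
    and \<theta>s_inj: "inj_on \<theta>s {..d}"
    and \<theta>s_eigenvalues: "eigenvalues scale As = \<theta>s ` {..d}"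
    and Vs_def: "Vs = (\<lambda>i. eigenspace scale As (\<theta>s i))"
    and Vs_tridiagonal: "\<And>i. i \<le> d \<Longrightarrow>
        A ` Vs i \<subseteq> (\<Sum>k \<in> {k. k \<le> d \<and> i \<le> k + 1 \<and> k \<le> i + 1}. Vs k)"
    and Vm_def: "Vm = (\<lambda>i. H_map scale q d \<theta> V ` Vs i)"
    and K_def: "K = corresponding_map scale q d (\<lambda>i. (\<Sum>k\<le>i. Vs k) \<inter> (\<Sum>k=i..d. V k))"
    and B_def: "B = corresponding_map scale q d (\<lambda>i. (\<Sum>k\<le>i. Vs k) \<inter> (\<Sum>k\<le>d-i. V k))"
    and Kd_def: "Kd = corresponding_map scale q d (\<lambda>i. (\<Sum>k=d-i..d. Vs k) \<inter> (\<Sum>k=i..d. V k))"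
    and Bd_def: "Bd = corresponding_map scale q d (\<lambda>i. (\<Sum>k=d-i..d. Vs k) \<inter> (\<Sum>k\<le>d-i. V k))"
    and M_def: "M = (\<lambda>v. scale (inverse (a - inverse a)) (scale a (K v) - scale (inverse a) (B v)))"
    and Md_def: "Md = (\<lambda>v. scale (inverse (a - inverse a)) (scale a (Kd v) - scale (inverse a) (Bd v)))"
  shows
    "(goes_from_to scale q d B (flag_first Vs) (flag_first V) \<and>
      goes_from_to scale q d K (flag_first Vs) (flag_last d V) \<and>
      goes_from_to scale q d Bd (flag_last d Vs) (flag_first V) \<and>
      goes_from_to scale q d Kd (flag_last d Vs) (flag_last d V)) \<and>
     (goes_from_to scale q d (\<lambda>v. scale (inverse a) (A v) - scale (inverse a ^ 2) (B v))
        (flag_first V) (flag_first Vm) \<and>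
      goes_from_to scale q d (\<lambda>v. scale a (A v) - scale (a ^ 2) (K v))
        (flag_last d V) (flag_first Vm) \<and>
      goes_from_to scale q d (\<lambda>v. scale (inverse a) (A v) - scale (inverse a ^ 2) (Bd v))
        (flag_first V) (flag_last d Vm) \<and>
      goes_from_to scale q d (\<lambda>v. scale a (A v) - scale (a ^ 2) (Kd v))
        (flag_last d V) (flag_last d Vm)) \<and>
     (goes_from_to scale q d M (flag_first Vs) (flag_first Vm) \<and>
      goes_from_to scale q d Md (flag_last d Vs) (flag_last d Vm))"
proof -
  have vs: "vector_space scale"
    and hom: "\<rho> \<in> ring_hom (qOnsager q) (End_ring scale)"
    and scalar: "\<And>c. \<rho> (qOnsager_class q (free_scalar c)) = scale c"
    and simple: "\<And>W. qOnsager_submodule scale q \<rho> W \<Longrightarrow> W = {0} \<or> W = UNIV"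
    using irred by (simp_all add: irreducible_qOnsager_module_def qOnsager_module_def)
  interpret qOnsager_action scale q \<rho>
    by (intro qOnsager_action.intro operators_on_vector_space.intro qOnsager_action_axioms.intro vs hom scalar)
  have A: "A = act (free_gen GenA)" and As: "As = act (free_gen GenAstar)"
    by (simp_all add: A_def As_def act_def qOnsager_gen_def)
  have irreducible: "irreducible_pair A As"
    unfolding irreducible_pair_def A As using simple invariant_imp_submodule by blast
  have As_endo: "endo As" unfolding As by (rule act_endo)
  interpret pair: q_racah_pair scale q a d A As \<theta>
    by (intro q_racah_pair.intro q_racah_pair_axioms.intro operators_on_vector_space_axioms
        q_nz q_not_root a_nz d_ge A_diag \<theta>_eigenvalues \<theta>_form \<theta>_inj As_endo irreducible)
       (use act_q_Dolan_Grady[OF q_nz] in \<open>simp_all add: A As\<close>)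
  have V: "pair.V = V" by (simp add: V_def pair.V_def[abs_def])
  \<comment> \<open>The eigenspaces of \<open>As\<close> in their given order lead to \<open>K\<close>, \<open>B\<close> and \<open>M\<close>, in the reversed order to
    \<open>Kd\<close>, \<open>Bd\<close> and \<open>Md\<close>.\<close>
  have decomposition: "direct_decomposition d Vs" and nonzero: "\<And>i. i \<le> d \<Longrightarrow> Vs i \<noteq> {0}"
    using eigenspace_decomposition[OF As_diag \<theta>s_eigenvalues \<theta>s_inj] by (simp_all add: Vs_def)
  have sub: "subspace (Vs i)" for i unfolding Vs_def by (rule subspace_eigenspace[OF As_endo])
  have scales: "As w = scale (\<theta>s i) w" if "w \<in> Vs i" for i w
    using that by (simp add: Vs_def eigenspace_def)
  have tri: "tridiagonal d A Vs" unfolding tridiagonal_def using Vs_tridiagonal by blast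
  have Vm: "(\<Sum>k\<in>I. Vm (f k)) = pair.H ` (\<Sum>k\<in>I. Vs (f k))" for I :: "nat set" and f
    unfolding image_sum_sets[OF pair.H_endo] by (simp add: Vm_def V)
  have flags: "flag d (partial_sums Vs)" "flag d (partial_sums (\<lambda>i. Vs (d - i)))"
    using flag_partial_sums[OF decomposition nonzero]
      flag_partial_sums[OF decomposition_reverse[OF decomposition]] nonzero by simp_all
  have raising: "raises d A (partial_sums Vs)" "raises d A (partial_sums (\<lambda>i. Vs (d - i)))"
    using tridiagonal_raises[OF pair.A sub tri]
      tridiagonal_raises[OF pair.A _ tridiagonal_reverse[OF tri]] sub by simp_all
  have lowering: "lowers d As \<theta>s (partial_sums Vs)"
      "lowers d As (\<lambda>i. \<theta>s (d - i)) (partial_sums (\<lambda>i. Vs (d - i)))"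
    by (intro lowers_partial_sums[OF As_endo] sub scales; assumption)+
  have first: "flag_first Vs i = partial_sums Vs (Suc i)"
      "flag_first Vm i = pair.H ` partial_sums Vs (Suc i)" for i
    using Vm[of "\<lambda>i. i"] by (simp_all add: flag_first_def partial_sums_def lessThan_Suc_atMost)
  have last: "flag_last d Vs i = partial_sums (\<lambda>i. Vs (d - i)) (Suc i)"
      "flag_last d Vm i = pair.H ` partial_sums (\<lambda>i. Vs (d - i)) (Suc i)" if "i \<le> d" for i
    using Vm[of "\<lambda>i. d - i"] sum_atMost_reverse[OF that, of Vs] sum_atMost_reverse[OF that, of Vm]
    by (simp_all add: flag_last_def partial_sums_def lessThan_Suc_atMost)
  have maps:
      "K = corresponding_map scale q d (\<lambda>i. flag_first Vs i \<inter> (\<Sum>k=i..d. pair.V k))"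
      "B = corresponding_map scale q d (\<lambda>i. flag_first Vs i \<inter> (\<Sum>k\<le>d-i. pair.V k))"
      "Kd = corresponding_map scale q d (\<lambda>i. flag_last d Vs i \<inter> (\<Sum>k=i..d. pair.V k))"
      "Bd = corresponding_map scale q d (\<lambda>i. flag_last d Vs i \<inter> (\<Sum>k\<le>d-i. pair.V k))"
    by (simp_all add: K_def B_def Kd_def Bd_def flag_first_def flag_last_def V)
  note forward = pair.split_maps_go[OF flags(1) raising(1) lowering(1) maps(1,2) first, unfolded V]
  note backward = pair.split_maps_go[OF flags(2) raising(2) lowering(2) maps(3,4) last, unfolded V]
  show ?thesis
    unfolding M_def Md_def by (intro conjI forward backward)
qed

end
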